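(* The set of endorigid torsion-free abelian groups is a complete co-analytic subset of the Borel space $\mathrm{TFAB}_\omega$ of torsion-free abelian groups with domain $\omega$. In fact, more strongly, there is a Borel function $\mathbf{F}$ from the set of trees with domain $\omega$ into $\mathrm{TFAB}_\omega$ such that for every tree $T$ with domain $\omega$, writing $G = \mathbf{F}(T)$: \begin{enumerate} \item[(i)] if $T$ is well-founded, then $G$ is endorigid; \item[(ii)] if $T$ is not well-founded, then there is an injective $f \in \mathrm{End}(G)$ which is not multiplication by an integer and such that the quotient $G/f[G]$ is not a torsion group. \end{enumerate}
   Context: For a countable first-order language $L$, the set $\mathrm{K}^L_\omega$ of $L$-structures with domain $\omega$ is a standard Borel space (a structure being identified with the family of its relations and graphs of functions, as a point of a countable product space), and Borel subsets of it carry the induced Borel structure. $\mathrm{TFAB}_\omega$ is the space of torsion-free abelian groups with domain $\omega$. An abelian group $G$ is endorigid if every endomorphism of $G$ is multiplication by an integer, i.e. of the form $g \mapsto mg$ for some $m \in \mathbb{Z}$. A tree $(T, <_T)$ is a strict partial order such that for every $t \in T$ the set $\{s \in T : s <_T t\}$ is well-ordered by $<_T$ (more than one minimal element is allowed); only trees in which $\{s \in T : s <_T t\}$ is finite for every $t\in T$ are considered. A branch of $T$ is a maximal chain; $T$ is well-founded if it has only finite branches. For standard Borel spaces $X_1, X_2$ and $Y_1 \subseteq X_1$, $Y_2 \subseteq X_2$, $Y_2$ is reducible to $Y_1$ if there is a Borel map $\mathbf{B}: X_2 \rightarrow X_1$ such that for all $x \in X_2$, $x \in Y_2 \Leftrightarrow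 \mathbf{B}(x) \in Y_1$. $Y_1$ is a complete co-analytic subset of $X_1$ if for every standard Borel space $X_2$ every co-analytic $Y_2 \subseteq X_2$ is reducible to $Y_1$. *)

theory Defs
  imports "HOL-Analysis.Analysis" "HOL-Algebra.Coset"
begin

section \<open>Standard Borel spaces and co-analytic sets\<close>

text \<open>Throughout, a measurable space is given by a \<^typ>\<open>'a measure\<close> of which only the space and the
  sigma-algebra matter.\<close>

definition standard_borel_space :: "'a measure \<Rightarrow> bool" where
  "standard_borel_space M \<longleftrightarrow>
    (\<exists>X. completely_metrizable_space X \<and> second_countable X \<and>
         sets M = sigma_sets (topspace X) {U. openin X U})"

text \<open>A subset of a standard Borel space is analytic iff it is the projection of a Borel subset of
  the product with the Baire space; this form avoids quantifying over the type of an auxiliary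
  Polish space. Here \<^typ>\<open>nat \<Rightarrow> nat\<close> carries the product of discrete topologies.\<close>

definition analytic_set :: "'a measure \<Rightarrow> 'a set \<Rightarrow> bool" where
  "analytic_set X A \<longleftrightarrow> (\<exists>B \<in> sets (X \<Otimes>\<^sub>M (borel :: (nat \<Rightarrow> nat) measure)). A = fst ` B)"

definition coanalytic_set :: "'a measure \<Rightarrow> 'a set \<Rightarrow> bool" where
  "coanalytic_set X A \<longleftrightarrow> A \<subseteq> space X \<and> analytic_set X (space X - A)"

definition borel_reducible :: "'b measure \<Rightarrow> 'b set \<Rightarrow> 'a measure \<Rightarrow> 'a set \<Rightarrow> bool" where
  "borel_reducible X2 Y2 X1 Y1 \<longleftrightarrow>
    (\<exists>B \<in> measurable X2 X1. \<forall>x \<in> space X2. x \<in> Y2 \<longleftrightarrow> B x \<in> Y1)"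

text \<open>A definition cannot quantify over types, so the type of the points of the competing spaces
  is a parameter. A theorem with a free type variable there covers all standard Borel spaces.\<close>

definition complete_coanalytic :: "'b itself \<Rightarrow> 'a measure \<Rightarrow> 'a set \<Rightarrow> bool" where
  "complete_coanalytic _ X1 Y1 \<longleftrightarrow>
    standard_borel_space X1 \<and> Y1 \<subseteq> space X1 \<and>
    (\<forall>(X2 :: 'b measure) Y2. standard_borel_space X2 \<longrightarrow> coanalytic_set X2 Y2 \<longrightarrow>
       borel_reducible X2 Y2 X1 Y1)"


section \<open>Torsion-free abelian groups with domain omega\<close>

definition torsion_free :: "('a, 'm) monoid_scheme \<Rightarrow> bool" where
  "torsion_free G \<longleftrightarrow>
    (\<forall>x \<in> carrier G. \<forall>n::nat. 0 < n \<longrightarrow> x [^]\<^bsub>G\<^esub> n = \<one>\<^bsub>G\<^esub> \<longrightarrow> x = \<one>\<^bsub>G\<^esub>)"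

definition torsion_group :: "('a, 'm) monoid_scheme \<Rightarrow> bool" where
  "torsion_group G \<longleftrightarrow> (\<forall>x \<in> carrier G. \<exists>n::nat. 0 < n \<and> x [^]\<^bsub>G\<^esub> n = \<one>\<^bsub>G\<^esub>)"

text \<open>Groups are written multiplicatively in HOL-Algebra, so multiplication by the integer \<open>m\<close> is
  the \<open>m\<close>-th power map.\<close>

definition integer_multiplication :: "('a, 'm) monoid_scheme \<Rightarrow> ('a \<Rightarrow> 'a) \<Rightarrow> bool" where
  "integer_multiplication G f \<longleftrightarrow> (\<exists>m::int. \<forall>x \<in> carrier G. f x = x [^]\<^bsub>G\<^esub> m)"

definition endorigid :: "('a, 'm) monoid_scheme \<Rightarrow> bool" where
  "endorigid G \<longleftrightarrow> (\<forall>f \<in> hom G G. integer_multiplication G f)"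

text \<open>Structures with domain omega for the language with one binary function symbol and one
  constant symbol. Such a structure is identified with the pair consisting of the graphs of its
  operation and of its constant, a point of a countable power of the discrete two-point space, and
  inherits the Borel structure of that space.\<close>

definition group_structures :: "nat monoid measure" where
  "group_structures =
    vimage_algebra {G. carrier G = UNIV}
      (\<lambda>G. (\<lambda>(x, y, z). x \<otimes>\<^bsub>G\<^esub> y = z, \<lambda>z. \<one>\<^bsub>G\<^esub> = z))
      (borel :: ((nat \<times> nat \<times> nat \<Rightarrow> bool) \<times> (nat \<Rightarrow> bool)) measure)"

definition TFAB_omega :: "nat monoid measure" where
  "TFAB_omega = restrict_space group_structures {G. comm_group G \<and> torsion_free G}"


section \<open>Trees with domain omega\<close>

text \<open>\<open>T s t\<close> means that \<open>s\<close> is strictly below \<open>t\<close>.\<close>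

definition tree :: "('a \<Rightarrow> 'a \<Rightarrow> bool) \<Rightarrow> bool" where
  "tree T \<longleftrightarrow> irreflp T \<and> transp T \<and>
    (\<forall>t. totalp_on {s. T s t} T \<and> wfp_on {s. T s t} T \<and> finite {s. T s t})"

definition branch :: "('a \<Rightarrow> 'a \<Rightarrow> bool) \<Rightarrow> 'a set \<Rightarrow> bool" where
  "branch T B \<longleftrightarrow> pred_on.maxchain UNIV T B"

definition well_founded_tree :: "('a \<Rightarrow> 'a \<Rightarrow> bool) \<Rightarrow> bool" where
  "well_founded_tree T \<longleftrightarrow> (\<forall>B. branch T B \<longrightarrow> finite B)"

definition trees_omega :: "(nat \<Rightarrow> nat \<Rightarrow> bool) measure" where
  "trees_omega =
    restrict_space
      (vimage_algebra UNIV (\<lambda>T (s, t). T s t) (borel :: (nat \<times> nat \<Rightarrow> bool) measure))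
      {T. tree T}"

end

theory Submission
  imports Defs "HOL-Library.Poly_Mapping" "HOL-Library.Infinite_Set" "HOL-Library.Nat_Bijection"
    "HOL-Library.Sublist" "HOL-Computational_Algebra.Primes"
begin

text \<open>To a tree \<open>T\<close> we attach the rational vector space with basis \<open>Root n\<close> (one for each level) and
  \<open>Node t k\<close> (for \<open>t\<close> in \<open>T\<close>, to be thought of as \<open>f\<^sup>k\<close> applied to \<open>Node t 0\<close>), together with
  countably many linear maps, one for each prime \<open>p\<close>. The group consists of the vectors whose image
  under the map of \<open>p\<close> is \<open>p\<close>-integral, for all \<open>p\<close>. The elements infinitely divisible by \<open>p\<close> are then
  those in the kernel, so every endomorphism preserves all the kernels. The kernels say that the image
  of \<open>Root n\<close> lives at level \<open>n\<close>, that it is the projection of the image of \<open>Root (n + 1)\<close> along the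
  parent map, and that it determines the images of all the \<open>Node t k\<close>. Hence an endomorphism for which
  some \<open>Node t k\<close> occurs in the image of \<open>Root n\<close> yields an infinite increasing sequence in \<open>T\<close>, and
  without such an endomorphism only integer multiplications are left. Conversely an infinite branch
  \<open>t\<close> gives the endomorphism \<open>Root n \<mapsto> Node (t n) 0\<close>, \<open>Node s k \<mapsto> Node s (k + 1)\<close>, whose image avoids
  all multiples of \<open>Root 0\<close>.

  For completeness, every analytic set is the result of a Suslin operation on measurable sets, i.e. the
  set of points for which a tree of finite sequences depending measurably on the point has an infinite
  branch; and the operations of the groups with domain \<open>\<omega>\<close> form a \<open>G\<^sub>\<delta>\<close> set in a Polish space.\<close>

section \<open>Trees and their infinite branches\<close>

definition tree_level :: "('a \<Rightarrow> 'a \<Rightarrow> bool) \<Rightarrow> 'a \<Rightarrow> nat" where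
  "tree_level T t = card {s. T s t}"

lemma treeD:
  assumes "tree T"
  shows "\<not> T s s" "T r s \<Longrightarrow> T s t \<Longrightarrow> T r t" "finite {s. T s t}"
    "T r t \<Longrightarrow> T s t \<Longrightarrow> r = s \<or> T r s \<or> T s r"
proof -
  show "\<not> T s s" "finite {s. T s t}"
    using assms unfolding tree_def by (simp_all add: irreflpD)
  show "T r s \<Longrightarrow> T s t \<Longrightarrow> T r t"
    using assms transpD[of T r s t] unfolding tree_def by simp
  show "T r t \<Longrightarrow> T s t \<Longrightarrow> r = s \<or> T r s \<or> T s r"
    using assms totalp_onD[of "{s. T s t}" T r s] unfolding tree_def by auto
qed

lemma tree_level_less:
  assumes "tree T" "T s t"
  shows "tree_level T s < tree_level T t"
  unfolding tree_level_def
proof (rule psubset_card_mono)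
  show "finite {s. T s t}"
    using treeD(3)[OF assms(1)] .
  show "{r. T r s} \<subset> {r. T r t}"
    using assms treeD(1,2)[OF assms(1)] by blast
qed

lemma increasing_sequence_less:
  assumes "tree T" "\<And>n. T (t n) (t (Suc n))" "m < n"
  shows "T (t m) (t n)"
  using assms(3)
proof (induction n)
  case (Suc n)
  then show ?case
    using assms(2)[of n] treeD(2)[OF assms(1)] by (cases "m = n") auto
qed simp

text \<open>Levels strictly increase along the chain of predecessors, hence are injective on it.
  Their image lies in \<open>{..<tree_level T t}\<close> and has the same cardinality, so every
  smaller level is attained.\<close>

lemma tree_predecessor_at_level:
  assumes "tree T" "n < tree_level T t"
  obtains s where "T s t" "tree_level T s = n"
proof -
  have "inj_on (tree_level T) {s. T s t}"
  proof (rule inj_onI)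
    fix r s
    assume "r \<in> {s. T s t}" "s \<in> {s. T s t}" "tree_level T r = tree_level T s"
    then show "r = s"
      using treeD(4)[OF assms(1), of r t s] tree_level_less[OF assms(1), of r s]
        tree_level_less[OF assms(1), of s r] by auto
  qed
  then have "card (tree_level T ` {s. T s t}) = card {..<tree_level T t}"
    unfolding tree_level_def[of T t] by (simp add: card_image)
  moreover have "tree_level T ` {s. T s t} \<subseteq> {..<tree_level T t}"
    using tree_level_less[OF assms(1)] by auto
  ultimately have "tree_level T ` {s. T s t} = {..<tree_level T t}"
    by (simp add: card_subset_eq)
  with assms(2) have "n \<in> tree_level T ` {s. T s t}"
    by simp
  with that show thesis
    by blast
qed

text \<open>Zorn's lemma for the chains that contain \<open>C\<close>: the union of a nonempty
  family of them, linearly ordered by inclusion, is again one.\<close>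

lemma chain_in_branch:
  assumes "pred_on.chain UNIV T C"
  obtains B where "branch T B" "C \<subseteq> B"
proof -
  define A where "A = {D. pred_on.chain UNIV T D \<and> C \<subseteq> D}"
  have "\<exists>M\<in>A. \<forall>X\<in>A. M \<subseteq> X \<longrightarrow> X = M"
  proof (rule subset_Zorn_nonempty)
    show "A \<noteq> {}"
      using assms by (auto simp: A_def)
    fix \<C>
    assume "\<C> \<noteq> {}" and "subset.chain A \<C>"
    then have ne: "\<exists>D. D \<in> \<C>" and sub: "\<And>D. D \<in> \<C> \<Longrightarrow> D \<in> A"
      and lin: "\<And>D E. D \<in> \<C> \<Longrightarrow> E \<in> \<C> \<Longrightarrow> D \<subseteq> E \<or> E \<subseteq> D"
      by (auto simp: subset_chain_def)
    have "pred_on.chain UNIV T (\<Union>\<C>)"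
      unfolding pred_on.chain_def
    proof (intro conjI ballI)
      fix x y
      assume "x \<in> \<Union>\<C>" "y \<in> \<Union>\<C>"
      then obtain D E where "x \<in> D" "D \<in> \<C>" "y \<in> E" "E \<in> \<C>"
        by auto
      moreover from this have "D \<subseteq> E \<or> E \<subseteq> D"
        by (intro lin)
      ultimately obtain F where "x \<in> F" "y \<in> F" "F \<in> \<C>"
        by auto
      with sub[of F] show "T\<^sup>=\<^sup>= x y \<or> T\<^sup>=\<^sup>= y x"
        by (auto simp: A_def pred_on.chain_def)
    qed simp
    moreover have "C \<subseteq> \<Union>\<C>"
      using ne sub by (auto simp: A_def)
    ultimately show "\<Union>\<C> \<in> A"
      by (simp add: A_def)
  qed
  then obtain M where M: "M \<in> A" and max: "\<forall>X\<in>A. M \<subseteq> X \<longrightarrow> X = M"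
    by (rule bexE)
  have "\<not> (pred_on.chain UNIV T X \<and> M \<subset> X)" for X
    using M max by (auto simp: A_def)
  with M have "branch T M" "C \<subseteq> M"
    by (simp_all add: A_def branch_def pred_on.maxchain_def)
  with that show thesis
    by simp
qed

lemma increasing_sequence_not_well_founded:
  assumes "tree T" "\<And>n. T (t n) (t (Suc n))"
  shows "\<not> well_founded_tree T"
proof -
  note mono = increasing_sequence_less[where T = T and t = t, OF assms]
  have "inj t"
  proof (rule linorder_injI)
    fix m n :: nat
    assume "m < n"
    then show "t m \<noteq> t n"
      using mono[of m n] treeD(1)[OF assms(1)] by auto
  qed
  then have "infinite (range t)"
    by (simp add: range_inj_infinite)
  moreover have "pred_on.chain UNIV T (range t)"
    unfolding pred_on.chain_def
  proof (intro conjI ballI)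
    fix x y
    assume "x \<in> range t" "y \<in> range t"
    then obtain m n where "x = t m" "y = t n"
      by blast
    then show "T\<^sup>=\<^sup>= x y \<or> T\<^sup>=\<^sup>= y x"
      using mono[of m n] mono[of n m] by (cases m n rule: linorder_cases) auto
  qed simp
  then obtain B where "branch T B" "range t \<subseteq> B"
    by (rule chain_in_branch)
  ultimately show ?thesis
    unfolding well_founded_tree_def using finite_subset by blast
qed

text \<open>For each \<open>n\<close> a node of level \<open>n\<close> is chosen below some element
  of an infinite branch. Two such nodes have a common upper bound, so they are comparable, and their
  levels decide the order. The exact levels matter later, when \<open>Root n\<close> is sent to
  \<open>Node (t n) 0\<close>.\<close>

lemma not_well_founded_increasing_sequence:
  assumes "tree T" "\<not> well_founded_tree T"
  obtains t where "\<And>n. T (t n) (t (Suc n))" "\<And>n. tree_level T (t n) = n"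
proof -
  note D = treeD[OF assms(1)]
  obtain B where B: "branch T B" "infinite B"
    using assms(2) unfolding well_founded_tree_def by blast
  then have ch: "x = y \<or> T x y \<or> T y x" if "x \<in> B" "y \<in> B" for x y
    using that unfolding branch_def pred_on.maxchain_def pred_on.chain_def by blast
  have inj: "inj_on (tree_level T) B"
    using ch tree_level_less[OF assms(1)] by (intro inj_onI) (metis less_irrefl)
  \<comment> \<open>Levels are injective on the infinite set \<open>B\<close>, hence unbounded
    there, and below a node of level greater than \<open>n\<close> there is one of level
    \<open>n\<close>.\<close>
  have "\<exists>t. tree_level T t = n \<and> (\<exists>b\<in>B. T t b)" for n
  proof -
    have "infinite (tree_level T ` B)"
      using inj B(2) finite_image_iff by blast
    then obtain b where b: "b \<in> B" "n < tree_level T b"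
      unfolding infinite_nat_iff_unbounded by blast
    obtain s where "T s b" "tree_level T s = n"
      using tree_predecessor_at_level[OF assms(1) b(2)] .
    with b(1) show ?thesis
      by blast
  qed
  then obtain t where t: "\<And>n. tree_level T (t n) = n" "\<And>n. \<exists>b\<in>B. T (t n) b"
    by metis
  have "T (t n) (t (Suc n))" for n
  proof -
    obtain b c where b: "b \<in> B" "T (t n) b" and c: "c \<in> B" "T (t (Suc n)) c"
      using t(2) by blast
    then obtain d where "T (t n) d" "T (t (Suc n)) d"
      using ch[of b c] D(2) by blast
    with D(4) have "t n = t (Suc n) \<or> T (t n) (t (Suc n)) \<or> T (t (Suc n)) (t n)"
      by blast
    then show ?thesis
      using t(1)[of n] t(1)[of "Suc n"] tree_level_less[OF assms(1), of "t (Suc n)" "t n"] by auto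
  qed
  with t(1) that show thesis
    by blast
qed

section \<open>Groups of vectors with prime-wise integrality conditions\<close>

abbreviation "lookup \<equiv> Poly_Mapping.lookup"
abbreviation "keys \<equiv> Poly_Mapping.keys"

section \<open>Rational vectors of finite support and linear extension from a basis\<close>

definition qscale :: "rat \<Rightarrow> ('a \<Rightarrow>\<^sub>0 rat) \<Rightarrow> ('a \<Rightarrow>\<^sub>0 rat)" where
  "qscale c v = Poly_Mapping.map ((*) c) v"

lemma lookup_qscale [simp]: "lookup (qscale c v) x = c * lookup v x"
  unfolding qscale_def by transfer (simp add: when_def)

lemma qscale_add_right: "qscale c (v + w) = qscale c v + qscale c w"
  by (rule poly_mapping_eqI) (simp add: lookup_add algebra_simps)

lemma qscale_add_left: "qscale (c + d) v = qscale c v + qscale d v"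
  by (rule poly_mapping_eqI) (simp add: lookup_add algebra_simps)

lemma qscale_qscale [simp]: "qscale c (qscale d v) = qscale (c * d) v"
  by (rule poly_mapping_eqI) simp

lemma qscale_zero_left [simp]: "qscale 0 v = 0"
  and qscale_zero_right [simp]: "qscale c 0 = 0"
  and qscale_one [simp]: "qscale 1 v = v"
  and qscale_minus_left: "qscale (- c) v = - qscale c v"
  by (rule poly_mapping_eqI, simp)+

lemma qscale_eq_0_iff: "qscale c v = 0 \<longleftrightarrow> c = 0 \<or> v = 0"
  by (auto simp: poly_mapping_eq_iff fun_eq_iff)

lemma qscale_sum: "qscale c (sum f A) = (\<Sum>x\<in>A. qscale c (f x))"
  by (rule poly_mapping_eqI) (simp add: lookup_sum sum_distrib_left)

lemma qscale_single [simp]: "qscale c (Poly_Mapping.single x d) = Poly_Mapping.single x (c * d)"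
  by (rule poly_mapping_eqI) (simp add: lookup_single when_def)

definition lin :: "('a \<Rightarrow> ('b \<Rightarrow>\<^sub>0 rat)) \<Rightarrow> ('a \<Rightarrow>\<^sub>0 rat) \<Rightarrow> ('b \<Rightarrow>\<^sub>0 rat)" where
  "lin \<phi> v = (\<Sum>x\<in>keys v. qscale (lookup v x) (\<phi> x))"

lemma lin_superset:
  assumes "finite S" "keys v \<subseteq> S"
  shows "lin \<phi> v = (\<Sum>x\<in>S. qscale (lookup v x) (\<phi> x))"
  unfolding lin_def by (rule sum.mono_neutral_left) (use assms in \<open>auto simp: in_keys_iff\<close>)

lemma lookup_lin: "lookup (lin \<phi> v) y = (\<Sum>x\<in>keys v. lookup v x * lookup (\<phi> x) y)"
  by (simp add: lin_def lookup_sum)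

lemma lin_add: "lin \<phi> (v + w) = lin \<phi> v + lin \<phi> w"
proof -
  let ?S = "keys v \<union> keys w"
  have "lin \<phi> u = (\<Sum>x\<in>?S. qscale (lookup u x) (\<phi> x))" if "keys u \<subseteq> ?S" for u
    using that by (intro lin_superset) auto
  moreover have "keys (v + w) \<subseteq> ?S"
    by (rule keys_add)
  ultimately show ?thesis
    by (simp add: lookup_add qscale_add_left sum.distrib)
qed

lemma lin_qscale: "lin \<phi> (qscale c v) = qscale c (lin \<phi> v)"
proof -
  have "keys (qscale c v) \<subseteq> keys v"
    by (auto simp: in_keys_iff)
  then have "lin \<phi> (qscale c v) = (\<Sum>x\<in>keys v. qscale (lookup (qscale c v) x) (\<phi> x))"
    by (intro lin_superset) auto
  then show ?thesis
    by (simp add: lin_def qscale_sum)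
qed

lemma lin_zero [simp]: "lin \<phi> 0 = 0"
  by (simp add: lin_def)

lemma lin_uminus: "lin \<phi> (- v) = - lin \<phi> v"
  using lin_qscale[of \<phi> "- 1" v] by (simp add: qscale_minus_left)

lemma lin_single [simp]: "lin \<phi> (Poly_Mapping.single x c) = qscale c (\<phi> x)"
  by (cases "c = 0") (simp_all add: lin_def)

lemma lin_sum: "lin \<phi> (sum f A) = (\<Sum>x\<in>A. lin \<phi> (f x))"
  by (induction A rule: infinite_finite_induct) (simp_all add: lin_add)

lemma lin_lin: "lin \<psi> (lin \<phi> v) = lin (\<lambda>x. lin \<psi> (\<phi> x)) v"
  by (simp add: lin_def[of \<phi>] lin_def[of "\<lambda>x. lin \<psi> (\<phi> x)"] lin_sum lin_qscale)

lemma lin_cong: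
  assumes "\<And>x. x \<in> keys v \<Longrightarrow> \<phi> x = \<psi> x"
  shows "lin \<phi> v = lin \<psi> v"
  using assms by (simp add: lin_def)

abbreviation basis :: "'a \<Rightarrow> ('a \<Rightarrow>\<^sub>0 rat)" where
  "basis x \<equiv> Poly_Mapping.single x 1"

lemma lin_basis [simp]: "lin basis v = v"
proof (rule poly_mapping_eqI)
  fix y
  have "(\<Sum>x\<in>keys v. lookup v x * lookup (basis x) y) =
      (\<Sum>x\<in>keys v. if x = y then lookup v y else 0)"
    by (intro sum.cong) (auto simp: lookup_single when_def)
  then show "lookup (lin basis v) y = lookup v y"
    by (simp add: lookup_lin in_keys_iff)
qed

lemma lookup_lin_basis_inj:
  assumes "inj f"
  shows "lookup (lin (\<lambda>x. basis (f x)) v) (f y) = lookup v y"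
proof -
  have "lookup (lin (\<lambda>x. basis (f x)) v) (f y) = lookup (lin basis v) y"
    unfolding lookup_lin using assms
    by (intro sum.cong) (auto simp: lookup_single when_def inj_eq)
  then show ?thesis
    by simp
qed

section \<open>The localization of the integers at a prime\<close>

definition p_integral :: "nat \<Rightarrow> rat \<Rightarrow> bool" where
  "p_integral p q \<longleftrightarrow> (\<exists>b::int. \<not> int p dvd b \<and> of_int b * q \<in> \<int>)"

lemma p_integral_of_Ints:
  assumes "prime p" "q \<in> \<int>"
  shows "p_integral p q"
  unfolding p_integral_def using assms not_prime_1 by (intro exI[of _ 1]) auto

lemma not_dvd_mult_prime:
  assumes "prime p" "\<not> int p dvd a" "\<not> int p dvd b"
  shows "\<not> int p dvd a * b"
  using assms by (simp add: prime_dvd_mult_iff)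

text \<open>The product of the two denominators serves for the combination. Taking
  \<open>s = 1\<close> gives closure under sums, and \<open>q = 0\<close> closure under integer
  multiples.\<close>

lemma p_integral_mult_add:
  assumes "prime p" "p_integral p q" "p_integral p r" "s \<in> \<int>"
  shows "p_integral p (q + s * r)"
proof -
  obtain a b where a: "\<not> int p dvd a" "of_int a * q \<in> \<int>" and b: "\<not> int p dvd b" "of_int b * r \<in> \<int>"
    using assms unfolding p_integral_def by auto
  have "of_int (a * b) * (q + s * r) =
      of_int b * (of_int a * q) + of_int a * (s * (of_int b * r))"
    by (simp add: algebra_simps)
  also have "\<dots> \<in> \<int>"
    using Ints_mult[OF Ints_of_int a(2), of b] Ints_mult[OF Ints_of_int Ints_mult[OF assms(4) b(2)], of a]
    by (rule Ints_add)
  finally show ?thesis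
    unfolding p_integral_def using not_dvd_mult_prime[OF assms(1) a(1) b(1)] by auto
qed

lemma p_integral_sum:
  assumes "prime p" "\<And>x. x \<in> A \<Longrightarrow> p_integral p (f x)" "\<And>x. x \<in> A \<Longrightarrow> g x \<in> \<int>"
  shows "p_integral p (\<Sum>x\<in>A. f x * g x)"
  using assms(2,3)
proof (induction A rule: infinite_finite_induct)
  case (insert x A)
  then show ?case
    using p_integral_mult_add[OF assms(1), of "\<Sum>x\<in>A. f x * g x" "f x" "g x"]
    by (simp add: algebra_simps)
qed (simp_all add: p_integral_of_Ints assms(1))

text \<open>A prime other than \<open>p\<close> is a unit in the localization at
  \<open>p\<close>.\<close>

lemma p_integral_divide_other_prime:
  assumes "prime p" "prime r" "p \<noteq> r" "p_integral p q"
  shows "p_integral p (q / of_nat r ^ m)"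
proof -
  obtain b where b: "\<not> int p dvd b" "of_int b * q \<in> \<int>"
    using assms unfolding p_integral_def by auto
  have "\<not> int p dvd int r ^ m"
    using assms primes_dvd_imp_eq[of p r] prime_dvd_power[of p r m]
    unfolding of_nat_power[symmetric] of_nat_dvd_iff by blast
  then have "\<not> int p dvd b * int r ^ m"
    using b(1) assms(1) by (intro not_dvd_mult_prime)
  moreover have "of_int (b * int r ^ m) * (q / of_nat r ^ m) \<in> (\<int> :: rat set)"
    using b(2) assms(2) prime_gt_0_nat[of r] by simp
  ultimately show ?thesis
    unfolding p_integral_def by (intro exI[of _ "b * int r ^ m"] conjI)
qed

lemma rat_fraction:
  fixes q :: rat
  obtains a d :: int where "q = of_int a / of_int d" "d > 0" "coprime a d"
proof (cases "quotient_of q")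
  case (Pair a d)
  then show thesis
    using that[of a d] quotient_of_div[OF Pair] quotient_of_denom_pos[OF Pair]
      quotient_of_coprime[OF Pair] by simp
qed

lemma p_integral_infinitely_divisible:
  assumes "prime p" "\<And>m. p_integral p (q / of_nat p ^ m)"
  shows "q = 0"
proof (rule ccontr)
  assume "q \<noteq> 0"
  obtain a d where q: "q = of_int a / of_int d" "d > 0" "coprime a d"
    by (rule rat_fraction)
  with \<open>q \<noteq> 0\<close> have "a \<noteq> 0"
    by auto
  \<comment> \<open>With the absolute value of the numerator as exponent, \<open>p ^ m\<close> is
    already too large to divide it.\<close>
  define m where "m = nat \<bar>a\<bar>"
  obtain b where b: "\<not> int p dvd b" "of_int b * (q / of_nat p ^ m) \<in> \<int>"
    using assms(2)[of m] unfolding p_integral_def by auto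
  then obtain k where "of_int b * (q / of_nat p ^ m) = of_int k"
    unfolding Ints_def by auto
  then have "(of_int (b * a) :: rat) = of_int (k * d * int p ^ m)"
    using q(2) prime_gt_0_nat[OF assms(1)] by (simp add: q(1) field_simps)
  then have "b * a = k * d * int p ^ m"
    by (simp only: of_int_eq_iff)
  then have "int p ^ m dvd b * a"
    by simp
  moreover have "coprime (int p ^ m) b"
    using b(1) assms(1) by (simp add: prime_imp_coprime)
  ultimately have "int p ^ m dvd a"
    by (simp add: coprime_dvd_mult_right_iff)
  then have "int p ^ m \<le> \<bar>a\<bar>"
    using \<open>a \<noteq> 0\<close> dvd_imp_le_int[of a "int p ^ m"] by simp
  moreover have "m < p ^ m"
    using prime_gt_1_nat[OF assms(1)] by (intro power_gt_expt) simp
  then have "\<bar>a\<bar> < int p ^ m"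
    unfolding m_def by (simp add: nat_less_iff)
  ultimately show False
    by simp
qed

text \<open>The localizations at all primes intersect in the integers: a prime factor of the reduced
  denominator \<open>d\<close> would divide the witness \<open>b\<close> of integrality at that
  prime.\<close>

lemma p_integral_all_primes:
  assumes "\<And>p. prime p \<Longrightarrow> p_integral p q"
  shows "q \<in> \<int>"
proof -
  obtain a d where q: "q = of_int a / of_int d" "d > 0" "coprime a d"
    by (rule rat_fraction)
  have "d = 1"
  proof (rule ccontr)
    assume "d \<noteq> 1"
    then have "nat d \<noteq> 1"
      using q(2) by auto
    then obtain p where p: "prime p" "p dvd nat d"
      using prime_factor_nat by blast
    obtain b k where b: "\<not> int p dvd b" "of_int b * q = of_int k"
      using assms[OF p(1)] unfolding p_integral_def Ints_def by auto
    then have "(of_int (b * a) :: rat) = of_int (k * d)"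
      using q(2) by (simp add: q(1) field_simps)
    then have "b * a = k * d"
      by (simp only: of_int_eq_iff)
    then have "d dvd b * a"
      by simp
    then have "d dvd b"
      using q(3) by (simp add: coprime_dvd_mult_left_iff coprime_commute)
    moreover have "int p dvd d"
      using p(2) q(2) by (simp add: nat_dvd_iff int_dvd_int_iff[symmetric])
    ultimately show False
      using b(1) dvd_trans by blast
  qed
  with q(1) show ?thesis
    by simp
qed

section \<open>Groups defined by one integrality condition for each prime, and their
  endomorphisms\<close>

definition vec_integral :: "nat \<Rightarrow> ('a \<Rightarrow>\<^sub>0 rat) \<Rightarrow> bool" where
  "vec_integral p v \<longleftrightarrow> (\<forall>y. p_integral p (lookup v y))"

lemma vec_integral_add: "prime p \<Longrightarrow> vec_integral p v \<Longrightarrow> vec_integral p w \<Longrightarrow> vec_integral p (v + w)"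
  unfolding vec_integral_def using p_integral_mult_add[of p _ _ 1] by (simp add: lookup_add)

lemma vec_integral_lin:
  assumes "prime p" "vec_integral p v" "\<And>x y. lookup (\<phi> x) y \<in> \<int>"
  shows "vec_integral p (lin \<phi> v)"
  using assms unfolding vec_integral_def lookup_lin by (intro allI p_integral_sum) auto

lemma vec_integral_of_Ints:
  assumes "prime p" "\<And>x. lookup v x \<in> \<int>"
  shows "vec_integral p v"
  using assms by (simp add: vec_integral_def p_integral_of_Ints)

lemma vec_integral_qscale_Ints:
  assumes "prime p" "c \<in> \<int>" "vec_integral p v"
  shows "vec_integral p (qscale c v)"
  unfolding vec_integral_def using assms p_integral_mult_add[OF assms(1) _ _ assms(2), of 0]
  by (simp add: vec_integral_def p_integral_of_Ints)

text \<open>The kernel of \<open>lin (\<pi> p)\<close> within the group turns out to be the set of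
  elements divisible by all powers of \<open>p\<close>, so it can be recovered from the abstract
  group.\<close>

definition prime_group :: "(nat \<Rightarrow> 'a \<Rightarrow> ('a \<Rightarrow>\<^sub>0 rat)) \<Rightarrow> ('a \<Rightarrow>\<^sub>0 rat) set" where
  "prime_group \<pi> = {v. \<forall>p. prime p \<longrightarrow> vec_integral p (lin (\<pi> p) v)}"

definition additive_on :: "'v::plus set \<Rightarrow> ('v \<Rightarrow> 'v) \<Rightarrow> bool" where
  "additive_on H h \<longleftrightarrow> (\<forall>v\<in>H. h v \<in> H) \<and> (\<forall>v\<in>H. \<forall>w\<in>H. h (v + w) = h v + h w)"

lemma prime_group_add: "v \<in> prime_group \<pi> \<Longrightarrow> w \<in> prime_group \<pi> \<Longrightarrow> v + w \<in> prime_group \<pi>"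
  by (simp add: prime_group_def lin_add vec_integral_add)

lemma prime_group_qscale_Ints: "c \<in> \<int> \<Longrightarrow> v \<in> prime_group \<pi> \<Longrightarrow> qscale c v \<in> prime_group \<pi>"
  by (simp add: prime_group_def lin_qscale vec_integral_qscale_Ints)

lemma prime_group_uminus: "v \<in> prime_group \<pi> \<Longrightarrow> - v \<in> prime_group \<pi>"
  using prime_group_qscale_Ints[of "- 1" v \<pi>] by (simp add: qscale_minus_left)

lemma prime_group_zero: "0 \<in> prime_group \<pi>"
  by (simp add: prime_group_def vec_integral_def p_integral_of_Ints)

text \<open>When \<open>\<pi> p\<close> is a projection, the second hypothesis says that
  \<open>lin \<phi>\<close> preserves its kernel. It allows \<open>v\<close> to be replaced by its
  image under \<open>\<pi> p\<close>, which is \<open>p\<close>-integral, and maps with integer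
  entries keep it so.\<close>

lemma prime_group_lin:
  assumes "\<And>x y. lookup (\<phi> x) y \<in> \<int>"
    and "\<And>p x. prime p \<Longrightarrow> lin (\<pi> p) (\<phi> x) = lin (\<pi> p) (lin \<phi> (\<pi> p x))"
    and "\<And>p x y. lookup (\<pi> p x) y \<in> \<int>"
    and "v \<in> prime_group \<pi>"
  shows "lin \<phi> v \<in> prime_group \<pi>"
proof -
  have "vec_integral p (lin (\<pi> p) (lin \<phi> v))" if "prime p" for p
  proof -
    have "lin (\<lambda>x. lin (\<pi> p) (\<phi> x)) v = lin (\<lambda>x. lin (\<pi> p) (lin \<phi> (\<pi> p x))) v"
      by (rule lin_cong) (rule assms(2)[OF that])
    then have "lin (\<pi> p) (lin \<phi> v) = lin (\<pi> p) (lin \<phi> (lin (\<pi> p) v))"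
      by (simp only: lin_lin)
    then show ?thesis
      using assms that by (simp add: prime_group_def vec_integral_lin)
  qed
  then show ?thesis
    by (simp add: prime_group_def)
qed

lemma Ints_in_prime_group:
  assumes "\<And>p x y. lookup (\<pi> p x) y \<in> \<int>" "\<And>x. lookup v x \<in> \<int>"
  shows "v \<in> prime_group \<pi>"
  using assms by (simp add: prime_group_def vec_integral_lin vec_integral_of_Ints)

lemma additive_on_zero:
  fixes H :: "'v::ab_group_add set"
  assumes "additive_on H h" "0 \<in> H"
  shows "h 0 = 0"
proof -
  have "h (0 + 0) = h 0 + h 0"
    using assms unfolding additive_on_def by (metis (no_types))
  then show ?thesis
    by simp
qed

lemma additive_on_prime_group_qscale:
  assumes "additive_on (prime_group \<pi>) h" "v \<in> prime_group \<pi>" "c \<in> \<int>"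
  shows "h (qscale c v) = qscale c (h v)"
proof -
  have nat: "h (qscale (of_nat n) v) = qscale (of_nat n) (h v)" for n
  proof (induction n)
    case 0
    then show ?case
      using additive_on_zero[OF assms(1) prime_group_zero] by simp
  next
    case (Suc n)
    then show ?case
      using assms(1,2) prime_group_qscale_Ints[of "of_nat n" v \<pi>]
      by (simp add: qscale_add_left additive_on_def)
  qed
  have neg: "h (- w) = - h w" if "w \<in> prime_group \<pi>" for w
  proof -
    have "h (w + - w) = h w + h (- w)"
      using assms(1) that prime_group_uminus[OF that] unfolding additive_on_def by (metis (no_types))
    then show ?thesis
      using additive_on_zero[OF assms(1) prime_group_zero] by (simp add: eq_neg_iff_add_eq_0 add.commute)
  qed
  obtain z where z: "c = of_int z"
    using assms(3) by (rule Ints_cases)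
  show ?thesis
  proof (cases z rule: int_cases2)
    case (nonneg n)
    with nat z show ?thesis
      by simp
  next
    case (nonpos n)
    with nat[of n] neg[OF prime_group_qscale_Ints[OF _ assms(2), of "of_nat n"]] z show ?thesis
      by (simp add: qscale_minus_left)
  qed
qed

text \<open>At \<open>p\<close> itself the image is zero, and at every other prime \<open>p\<close>
  is a unit.\<close>

lemma kernel_divisible_in_prime_group:
  assumes "prime p" "v \<in> prime_group \<pi>" "lin (\<pi> p) v = 0"
  shows "qscale (1 / of_nat p ^ m) v \<in> prime_group \<pi>"
proof -
  have "vec_integral r (qscale (1 / of_nat p ^ m) (lin (\<pi> r) v))" if "prime r" for r
  proof (cases "r = p")
    case True
    then show ?thesis
      using assms that by (simp add: vec_integral_def p_integral_of_Ints)
  next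
    case False
    then show ?thesis
      using assms(1,2) that p_integral_divide_other_prime[OF that assms(1), of _ m]
      by (simp add: prime_group_def vec_integral_def)
  qed
  then show ?thesis
    by (simp add: prime_group_def lin_qscale)
qed

lemma divisible_in_kernel:
  assumes "prime p" "\<And>m. qscale (1 / of_nat p ^ m) v \<in> prime_group \<pi>"
  shows "lin (\<pi> p) v = 0"
proof (rule poly_mapping_eqI)
  fix y
  have "p_integral p (lookup (lin (\<pi> p) v) y / of_nat p ^ m)" for m
    using assms(1) assms(2)[of m] by (simp add: prime_group_def lin_qscale vec_integral_def)
  then show "lookup (lin (\<pi> p) v) y = lookup 0 y"
    using p_integral_infinitely_divisible[OF assms(1)] by simp
qed

text \<open>Divisibility by all powers of \<open>p\<close> passes to images, because
  \<open>h v\<close> is \<open>p ^ m\<close> times the image of \<open>v\<close> divided by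
  \<open>p ^ m\<close>.\<close>

lemma additive_preserves_kernel:
  assumes "additive_on (prime_group \<pi>) h" "prime p" "v \<in> prime_group \<pi>" "lin (\<pi> p) v = 0"
  shows "lin (\<pi> p) (h v) = 0"
proof (rule divisible_in_kernel)
  fix m
  let ?w = "qscale (1 / of_nat p ^ m) v"
  have w: "?w \<in> prime_group \<pi>"
    using assms by (intro kernel_divisible_in_prime_group)
  have p: "p \<noteq> 0"
    using assms(2) by auto
  have "h v = h (qscale (of_nat p ^ m) ?w)"
    using p by simp
  also have "\<dots> = qscale (of_nat p ^ m) (h ?w)"
    by (intro additive_on_prime_group_qscale[OF assms(1) w]) simp
  finally show "qscale (1 / of_nat p ^ m) (h v) \<in> prime_group \<pi>"
    using p w assms(1) by (simp add: additive_on_def)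
qed fact

lemma common_denominator:
  obtains N :: nat where "N > 0" "\<forall>x. lookup (qscale (of_nat N) v) x \<in> \<int>"
proof -
  have "\<exists>N>0. \<forall>x\<in>A. of_nat N * lookup v x \<in> \<int>" if "finite A" for A
    using that
  proof induction
    case (insert x A)
    then obtain N where N: "N > 0" "\<forall>x\<in>A. of_nat N * lookup v x \<in> \<int>"
      by blast
    obtain a d where q: "lookup v x = of_int a / of_int d" "d > 0" "coprime a d"
      by (rule rat_fraction)
    have d: "of_nat (nat d) = (of_int d :: rat)"
      using q(2) by simp
    have "of_nat (nat d * N) * lookup v y \<in> \<int>" if "y \<in> insert x A" for y
    proof (cases "y = x")
      case True
      have "of_nat (nat d * N) * lookup v x = of_int (int N * a)"
        using q d by simp
      with True show ?thesis
        by (metis Ints_of_int)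
    next
      case False
      with that N(2) have "of_int d * (of_nat N * lookup v y) \<in> \<int>"
        by (intro Ints_mult[OF Ints_of_int]) auto
      then show ?thesis
        using d by (simp add: mult.assoc)
    qed
    moreover have "nat d * N > 0"
      using N(1) q(2) by simp
    ultimately show ?case
      by blast
  qed (auto intro: exI[of _ 1])
  then obtain N where N: "N > 0" "\<forall>x\<in>keys v. of_nat N * lookup v x \<in> \<int>"
    using finite_keys by blast
  then have "lookup (qscale (of_nat N) v) x \<in> \<int>" for x
    by (cases "x \<in> keys v") (auto simp: in_keys_iff)
  with N(1) that show thesis
    by blast
qed

text \<open>Some positive multiple of \<open>v\<close> is an integer combination of basis vectors,
  so \<open>h\<close> kills it; the ambient rational space has no torsion.\<close>

lemma additive_eq_0_if_basis:
  assumes "additive_on (prime_group \<pi>) h" "\<And>p x y. lookup (\<pi> p x) y \<in> \<int>"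
    and "\<And>x. h (basis x) = 0" "v \<in> prime_group \<pi>"
  shows "h v = 0"
proof -
  obtain N :: nat where N: "N > 0" "\<forall>x. lookup (qscale (of_nat N) v) x \<in> \<int>"
    by (rule common_denominator)
  let ?w = "qscale (of_nat N) v"
  let ?f = "\<lambda>x. qscale (lookup ?w x) (basis x)"
  have int: "sum ?f A \<in> prime_group \<pi>" for A
    using N(2) by (intro Ints_in_prime_group assms(2))
      (auto simp: lookup_sum lookup_single when_def intro!: Ints_sum)
  have f: "h (?f x) = 0" for x
  proof -
    have "basis x \<in> prime_group \<pi>"
      by (rule Ints_in_prime_group[OF assms(2)]) (simp add: lookup_single when_def)
    then show ?thesis
      using additive_on_prime_group_qscale[OF assms(1), of "basis x" "lookup ?w x"] N(2) assms(3)
      by simp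
  qed
  have "h (sum ?f A) = 0" if "finite A" for A
    using that
  proof induction
    case (insert x A)
    have "h (?f x + sum ?f A) = h (?f x) + h (sum ?f A)"
      using assms(1) int[of A] int[of "{x}"] unfolding additive_on_def by simp
    with insert f show ?case
      by simp
  qed (use additive_on_zero[OF assms(1) prime_group_zero] in simp)
  then have "h (lin basis ?w) = 0"
    unfolding lin_def by simp
  then have "qscale (of_nat N) (h v) = 0"
    using additive_on_prime_group_qscale[OF assms(1,4), of "of_nat N"] by simp
  with N(1) show ?thesis
    by (simp add: qscale_eq_0_iff)
qed

section \<open>The group of a tree\<close>

datatype gen = Root nat | Node nat nat

datatype constraint = Level nat | Diagonal nat | Linked nat nat

instance gen :: countable
  by countable_datatype

instance constraint :: countable
  by countable_datatype

fun gen_level :: "(nat \<Rightarrow> nat \<Rightarrow> bool) \<Rightarrow> gen \<Rightarrow> nat" where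
  "gen_level T (Root n) = n"
| "gen_level T (Node t k) = tree_level T t"

text \<open>In a tree the parent of a node of positive level is unique, and \<open>LEAST\<close>
  makes it a measurable function of \<open>T\<close>. At level 0 the value is arbitrary, but
  \<open>project\<close> takes parents only at levels of the form \<open>Suc n\<close>.\<close>

definition tree_parent :: "(nat \<Rightarrow> nat \<Rightarrow> bool) \<Rightarrow> nat \<Rightarrow> nat" where
  "tree_parent T t = (LEAST s. T s t \<and> tree_level T t = Suc (tree_level T s))"

fun gen_parent :: "(nat \<Rightarrow> nat \<Rightarrow> bool) \<Rightarrow> gen \<Rightarrow> gen" where
  "gen_parent T (Root n) = Root (n - 1)"
| "gen_parent T (Node t k) = Node (tree_parent T t) k"

text \<open>If \<open>Node s j\<close> is read as the \<open>(j + 1)\<close>-st iterate of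
  \<open>f\<close> at a root, the link carries an iterate of \<open>f\<close> at a root to the same
  iterate at \<open>Node t k\<close>. This gives the index \<open>k + j + 1\<close> and makes links
  commute with \<open>branch_shift\<close>.\<close>

fun gen_link :: "nat \<Rightarrow> nat \<Rightarrow> gen \<Rightarrow> gen" where
  "gen_link t k (Root n) = Node t k"
| "gen_link t k (Node s j) = Node t (k + j + 1)"

text \<open>For a tree these are projections. The kernel of \<open>Level n\<close> consists of the
  vectors supported at level \<open>n\<close>; that of \<open>Diagonal n\<close> contains
  \<open>Root n\<close> plus \<open>Root (Suc n)\<close>, and that of \<open>Linked t k\<close>
  contains \<open>Node t k\<close> plus \<open>Root (Suc (tree_level T t))\<close>. Since the two
  summands live at different levels, so do their images under an endomorphism.\<close>

fun project :: "(nat \<Rightarrow> nat \<Rightarrow> bool) \<Rightarrow> constraint \<Rightarrow> gen \<Rightarrow> (gen \<Rightarrow>\<^sub>0 rat)" where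
  "project T (Level n) x = (if gen_level T x = n then 0 else basis x)"
| "project T (Diagonal n) x = (if gen_level T x = Suc n then - basis (gen_parent T x) else basis x)"
| "project T (Linked t k) x =
    (if gen_level T x = Suc (tree_level T t) then - basis (gen_link t k x) else basis x)"

text \<open>The prime with index \<open>i\<close> in increasing order receives the constraint
  \<open>from_nat i\<close>, so that every constraint is imposed by some prime.\<close>

definition prime_constraint :: "nat \<Rightarrow> constraint" where
  "prime_constraint p = from_nat (inv_into UNIV (enumerate {q. prime q}) p)"

definition tree_vectors :: "(nat \<Rightarrow> nat \<Rightarrow> bool) \<Rightarrow> (gen \<Rightarrow>\<^sub>0 rat) set" where
  "tree_vectors T = prime_group (\<lambda>p. project T (prime_constraint p))"

lemma prime_constraint_surj:
  obtains p where "prime p" "prime_constraint p = c"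
proof -
  let ?e = "enumerate {q :: nat. prime q}"
  have "inj ?e"
    using strict_mono_enumerate[OF primes_infinite] by (rule strict_mono_imp_inj_on)
  then have "prime_constraint (?e (to_nat c)) = c"
    by (simp add: prime_constraint_def)
  moreover have "prime (?e (to_nat c))"
    using enumerate_in_set[OF primes_infinite] by simp
  ultimately show thesis
    using that by blast
qed

lemma tree_parent:
  assumes "tree T" "tree_level T t = Suc n"
  shows "T (tree_parent T t) t" "tree_level T (tree_parent T t) = n"
proof -
  obtain s where "T s t" "tree_level T s = n"
    using tree_predecessor_at_level[OF assms(1), of n t] assms(2) by auto
  then have "T s t \<and> tree_level T t = Suc (tree_level T s)"
    using assms(2) by simp
  then have "T (tree_parent T t) t \<and> tree_level T t = Suc (tree_level T (tree_parent T t))"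
    unfolding tree_parent_def by (rule LeastI)
  then show "T (tree_parent T t) t" "tree_level T (tree_parent T t) = n"
    using assms(2) by simp_all
qed

lemma tree_parent_unique:
  assumes "tree T" "T s t" "tree_level T t = Suc (tree_level T s)"
  shows "tree_parent T t = s"
proof -
  have p: "T (tree_parent T t) t" "tree_level T (tree_parent T t) = tree_level T s"
    using tree_parent[OF assms(1,3)] by auto
  from treeD(4)[OF assms(1) p(1) assms(2)] p(2) show ?thesis
    using tree_level_less[OF assms(1), of s "tree_parent T t"]
      tree_level_less[OF assms(1), of "tree_parent T t" s] by auto
qed

lemma gen_level_parent:
  assumes "tree T" "gen_level T x = Suc n"
  shows "gen_level T (gen_parent T x) = n"
  using assms tree_parent(2)[OF assms(1)] by (cases x) auto

lemma lookup_project_Ints: "lookup (project T c x) y \<in> \<int>"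
  by (cases c) (auto simp: lookup_single when_def)

lemma basis_in_tree_vectors: "basis x \<in> tree_vectors T"
  unfolding tree_vectors_def
  by (rule Ints_in_prime_group) (auto simp: lookup_project_Ints lookup_single when_def)

lemma lookup_project_Level:
  "lookup (lin (project T (Level n)) v) y = (if gen_level T y = n then 0 else lookup v y)"
proof -
  have "lookup (lin (project T (Level n)) v) y =
      (\<Sum>x\<in>keys v. if x = y then (if gen_level T y = n then 0 else lookup v y) else 0)"
    unfolding lookup_lin by (intro sum.cong) (auto simp: lookup_single when_def)
  then show ?thesis
    by (simp add: in_keys_iff)
qed

section \<open>Endomorphisms of the group of a tree, and rigidity in the well-founded case\<close>

lemma additive_preserves_constraint:
  assumes "additive_on (tree_vectors T) h" "v \<in> tree_vectors T" "lin (project T c) v = 0"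
  shows "lin (project T c) (h v) = 0"
proof -
  obtain p where "prime p" "prime_constraint p = c"
    using prime_constraint_surj .
  then show ?thesis
    using additive_preserves_kernel[OF assms(1)[unfolded tree_vectors_def], of p v] assms(2,3)
    by (simp add: tree_vectors_def)
qed

text \<open>A basis vector lies in the kernel of the \<open>Level\<close> constraint for its own
  level, and hence so does its image.\<close>

lemma additive_level:
  assumes "additive_on (tree_vectors T) h" "lookup (h (basis x)) y \<noteq> 0"
  shows "gen_level T y = gen_level T x"
proof -
  have "lin (project T (Level (gen_level T x))) (basis x) = 0"
    by simp
  then have "lin (project T (Level (gen_level T x))) (h (basis x)) = 0"
    by (rule additive_preserves_constraint[OF assms(1) basis_in_tree_vectors])
  then have "lookup (lin (project T (Level (gen_level T x))) (h (basis x))) y = 0"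
    by simp
  with assms(2) show ?thesis
    unfolding lookup_project_Level by (auto split: if_splits)
qed

lemma additive_on_basis_add:
  assumes "additive_on (tree_vectors T) h"
  shows "h (basis x + basis y) = h (basis x) + h (basis y)"
    and "basis x + basis y \<in> tree_vectors T"
proof -
  show "basis x + basis y \<in> tree_vectors T"
    using basis_in_tree_vectors unfolding tree_vectors_def by (intro prime_group_add)
  show "h (basis x + basis y) = h (basis x) + h (basis y)"
    using assms basis_in_tree_vectors unfolding additive_on_def by blast
qed

text \<open>The vector \<open>Root n\<close> plus \<open>Root (Suc n)\<close> lies in the kernel of
  \<open>Diagonal n\<close>, and so does its image. There the part at level \<open>n\<close> is kept
  while the part at level \<open>n + 1\<close> becomes minus its push-forward along the parent map,
  so the two cancel.\<close>

lemma additive_diagonal: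
  assumes "tree T" "additive_on (tree_vectors T) h" "gen_level T y = n"
  shows "lookup (h (basis (Root n))) y =
    (\<Sum>x\<in>keys (h (basis (Root (Suc n)))). if gen_parent T x = y then lookup (h (basis (Root (Suc n)))) x else 0)"
proof -
  define u w where "u = h (basis (Root n))" and "w = h (basis (Root (Suc n)))"
  have "lin (project T (Diagonal n)) (basis (Root n) + basis (Root (Suc n))) = 0"
    by (simp add: lin_add)
  then have "lin (project T (Diagonal n)) (h (basis (Root n) + basis (Root (Suc n)))) = 0"
    by (rule additive_preserves_constraint[OF assms(2) additive_on_basis_add(2)[OF assms(2)]])
  then have 0: "lin (project T (Diagonal n)) u + lin (project T (Diagonal n)) w = 0"
    by (simp add: additive_on_basis_add(1)[OF assms(2)] lin_add u_def w_def)
  have u: "gen_level T x = n" if "x \<in> keys u" for x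
    using additive_level[OF assms(2), of "Root n" x] that by (simp add: u_def in_keys_iff)
  have w: "gen_level T x = Suc n" if "x \<in> keys w" for x
    using additive_level[OF assms(2), of "Root (Suc n)" x] that by (simp add: w_def in_keys_iff)
  have "lin (project T (Diagonal n)) u = lin basis u"
    by (rule lin_cong) (simp add: u)
  moreover have "lookup (lin (project T (Diagonal n)) w) y =
      - (\<Sum>x\<in>keys w. if gen_parent T x = y then lookup w x else 0)"
    unfolding lookup_lin sum_negf[symmetric]
    by (intro sum.cong) (auto simp: w lookup_single when_def)
  ultimately show ?thesis
    using arg_cong[OF 0, of "\<lambda>v. lookup v y"]
    unfolding u_def[symmetric] w_def[symmetric] by (simp add: lookup_add)
qed

lemma well_founded_additive_Root:
  assumes "tree T" "well_founded_tree T" "additive_on (tree_vectors T) h"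
  obtains c where "\<forall>n. h (basis (Root n)) = qscale c (basis (Root n))"
proof -
  have node0: "lookup (h (basis (Root n))) (Node t k) = 0" for n t k
  proof (rule ccontr)
    assume start: "lookup (h (basis (Root n))) (Node t k) \<noteq> 0"
    \<comment> \<open>The index \<open>k\<close> is kept throughout; only the tree node moves, from
      level \<open>n + m\<close> to level \<open>n + m + 1\<close>.\<close>
    define P where "P m s \<longleftrightarrow> lookup (h (basis (Root (n + m)))) (Node s k) \<noteq> 0" for m s
    have step: "\<exists>s'. P (Suc m) s' \<and> T s s'" if "P m s" for m s
    proof -
      let ?w = "h (basis (Root (Suc (n + m))))"
      have lev: "gen_level T (Node s k) = n + m"
        using additive_level[OF assms(3), of "Root (n + m)" "Node s k"] that by (simp add: P_def)
      \<comment> \<open>A nonzero sum over the children of \<open>Node s k\<close> has a nonzero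
        term, which supplies the next node.\<close>
      have "(\<Sum>x\<in>keys ?w. if gen_parent T x = Node s k then lookup ?w x else 0) \<noteq> 0"
        using additive_diagonal[OF assms(1,3) lev] that by (simp add: P_def)
      then obtain x where x: "x \<in> keys ?w" "gen_parent T x = Node s k"
        by (auto elim!: sum.not_neutral_contains_not_neutral split: if_splits)
      then obtain s' where s': "x = Node s' k" "tree_parent T s' = s"
        by (cases x) auto
      have "gen_level T x = Suc (n + m)"
        using additive_level[OF assms(3), of "Root (Suc (n + m))" x] x(1) by (simp add: in_keys_iff)
      then have "T s s'"
        using tree_parent(1)[OF assms(1), of s' "n + m"] s' by simp
      moreover have "P (Suc m) s'"
        using x(1) s'(1) by (simp add: P_def in_keys_iff)
      ultimately show ?thesis
        by blast
    qed
    have "\<exists>f. \<forall>m. P m (f m) \<and> T (f m) (f (Suc m))"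
      using dependent_nat_choice[of P "\<lambda>m s s'. T s s'"] start step by (auto simp: P_def)
    then show False
      using increasing_sequence_not_well_founded[OF assms(1)] assms(2) by blast
  qed
  have root0: "lookup (h (basis (Root n))) (Root m) = 0" if "m \<noteq> n" for n m
    using additive_level[OF assms(3), of "Root n" "Root m"] that by auto
  define c where "c = (\<lambda>n. lookup (h (basis (Root n))) (Root n))"
  have eq: "h (basis (Root n)) = qscale (c n) (basis (Root n))" for n
  proof (rule poly_mapping_eqI)
    fix x
    show "lookup (h (basis (Root n))) x = lookup (qscale (c n) (basis (Root n))) x"
      by (cases x) (auto simp: node0 root0 c_def lookup_single when_def)
  qed
  \<comment> \<open>Both images are now multiples of a root, so the diagonal relation just compares
    the two coefficients.\<close>
  have "c (Suc n) = c n" for n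
    using additive_diagonal[OF assms(1,3), of "Root n" n]
    by (simp add: eq c_def[symmetric] split: if_splits)
  then have "c n = c 0" for n
    by (induction n) auto
  with eq that show thesis
    by metis
qed

text \<open>Once roots go to 0, the constraint \<open>Linked t k\<close> applies to the image of
  \<open>Node t k\<close> alone. That image lives at the level of \<open>t\<close>, where the
  constraint map is the identity, so it vanishes.\<close>

lemma additive_eq_0_if_Root:
  assumes "additive_on (tree_vectors T) h" "\<And>n. h (basis (Root n)) = 0" "v \<in> tree_vectors T"
  shows "h v = 0"
proof -
  have node: "h (basis (Node t k)) = 0" for t k
  proof -
    let ?w = "h (basis (Node t k))" and ?n = "Suc (tree_level T t)"
    have "lin (project T (Linked t k)) (basis (Root ?n) + basis (Node t k)) = 0"
      by (simp add: lin_add)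
    then have "lin (project T (Linked t k)) (h (basis (Root ?n) + basis (Node t k))) = 0"
      by (rule additive_preserves_constraint[OF assms(1) additive_on_basis_add(2)[OF assms(1)]])
    then have "lin (project T (Linked t k)) ?w = 0"
      by (simp add: additive_on_basis_add(1)[OF assms(1)] assms(2))
    moreover have "lin (project T (Linked t k)) ?w = lin basis ?w"
    proof (rule lin_cong)
      fix x
      assume "x \<in> keys ?w"
      then have "gen_level T x = tree_level T t"
        using additive_level[OF assms(1), of "Node t k" x] by (simp add: in_keys_iff)
      then show "project T (Linked t k) x = basis x"
        by simp
    qed
    ultimately show ?thesis
      by simp
  qed
  show ?thesis
  proof (rule additive_eq_0_if_basis[OF assms(1)[unfolded tree_vectors_def]])
    show "h (basis x) = 0" for x
      using assms(2) node by (cases x) auto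
  qed (use assms(3) in \<open>auto simp: lookup_project_Ints tree_vectors_def\<close>)
qed

text \<open>Each constraint fixes some root. At the corresponding prime, a multiple of that root
  belongs to the group only if the scalar is integral there; this makes the scalar of an
  endomorphism an integer.\<close>

lemma ex_Root_unconstrained:
  obtains n where "\<forall>q. lookup (lin (project T c) (qscale q (basis (Root n)))) (Root n) = q"
proof -
  obtain n where "project T c (Root n) = basis (Root n)"
  proof (cases c)
    case (Level m)
    then show thesis
      using that[of "Suc m"] by simp
  next
    case (Diagonal m)
    then show thesis
      using that[of m] by simp
  next
    case (Linked t k)
    then show thesis
      using that[of "tree_level T t"] by simp
  qed
  with that[of n] show thesis
    by simp
qed

lemma well_founded_additive_scalar:
  assumes "tree T" "well_founded_tree T" "additive_on (tree_vectors T) h"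
  obtains m :: int where "\<forall>v\<in>tree_vectors T. h v = qscale (of_int m) v"
proof -
  obtain c where c: "\<forall>n. h (basis (Root n)) = qscale c (basis (Root n))"
    using well_founded_additive_Root[OF assms] .
  have "c \<in> \<int>"
  proof (rule p_integral_all_primes)
    fix p :: nat
    assume p: "prime p"
    obtain n where n: "\<forall>q. lookup (lin (project T (prime_constraint p)) (qscale q (basis (Root n)))) (Root n) = q"
      using ex_Root_unconstrained .
    have "h (basis (Root n)) \<in> tree_vectors T"
      using assms(3) basis_in_tree_vectors unfolding additive_on_def by blast
    then have "qscale c (basis (Root n)) \<in> tree_vectors T"
      by (simp only: c)
    then have "p_integral p (lookup (lin (project T (prime_constraint p)) (qscale c (basis (Root n)))) (Root n))"
      using p unfolding tree_vectors_def prime_group_def vec_integral_def by blast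
    then show "p_integral p c"
      by (simp only: n)
  qed
  then obtain m where m: "c = of_int m"
    by (rule Ints_cases)
  \<comment> \<open>Subtracting multiplication by \<open>m\<close> leaves an additive map that kills
    all roots.\<close>
  let ?g = "\<lambda>v. h v + qscale (of_int (- m)) v"
  have "additive_on (tree_vectors T) ?g"
    using assms(3) unfolding additive_on_def tree_vectors_def
    by (auto simp: qscale_add_right algebra_simps simp del: of_int_minus
        intro!: prime_group_add prime_group_qscale_Ints)
  moreover have "?g (basis (Root n)) = 0" for n
    by (simp add: c m single_uminus)
  ultimately have "?g v = 0" if "v \<in> tree_vectors T" for v
    using that by (rule additive_eq_0_if_Root)
  then have "h v = qscale (of_int m) v" if "v \<in> tree_vectors T" for v
    using that by (simp add: qscale_minus_left)
  with that show thesis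
    by blast
qed

section \<open>The endomorphism given by an infinite branch\<close>

fun branch_shift :: "(nat \<Rightarrow> nat) \<Rightarrow> gen \<Rightarrow> gen" where
  "branch_shift t (Root n) = Node (t n) 0"
| "branch_shift t (Node s k) = Node s (Suc k)"

lemma inj_branch_shift:
  assumes "inj t"
  shows "inj (branch_shift t)"
proof (rule injI)
  fix x y
  assume "branch_shift t x = branch_shift t y"
  then show "x = y"
    using assms by (cases x; cases y) (auto simp: inj_eq)
qed

text \<open>The shift keeps levels and commutes with links and, at positive levels, with parents.
  For roots the latter means that \<open>t n\<close> is the parent of
  \<open>t (Suc n)\<close>.\<close>

lemma branch_shift_tree_vectors:
  assumes "tree T" "\<And>n. T (t n) (t (Suc n))" "\<And>n. tree_level T (t n) = n" "v \<in> tree_vectors T"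
  shows "lin (\<lambda>x. basis (branch_shift t x)) v \<in> tree_vectors T"
proof -
  have level: "gen_level T (branch_shift t x) = gen_level T x" for x
    by (cases x) (simp_all add: assms(3))
  have parent: "gen_parent T (branch_shift t x) = branch_shift t (gen_parent T x)"
    if "gen_level T x = Suc n" for n x
  proof (cases x)
    case (Root m)
    have "tree_parent T (t (Suc n)) = t n"
      by (rule tree_parent_unique[OF assms(1,2)]) (simp add: assms(3))
    with that Root show ?thesis
      by simp
  next
    case (Node s k)
    then show ?thesis
      by simp
  qed
  have link: "gen_link s k (branch_shift t x) = branch_shift t (gen_link s k x)" for s k x
    by (cases x) auto
  \<comment> \<open>A constraint map sends a generator to 0, to itself, or to minus a generator that
    it fixes, so compatibility with levels, parents and links is enough.\<close>
  have comm: "lin (project T c) (basis (branch_shift t x)) =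
      lin (project T c) (lin (\<lambda>x. basis (branch_shift t x)) (project T c x))" for c x
  proof (cases c)
    case (Level n)
    then show ?thesis
      by (simp add: level)
  next
    case (Diagonal n)
    then show ?thesis
      using gen_level_parent[OF assms(1), of x n] parent[of x n]
      by (auto simp: level lin_uminus)
  next
    case (Linked s k)
    have "gen_level T (gen_link s k x) = tree_level T s"
      by (cases x) auto
    with Linked show ?thesis
      by (auto simp: level link lin_uminus)
  qed
  show ?thesis
    unfolding tree_vectors_def
  proof (rule prime_group_lin)
    show "lin (project T (prime_constraint p)) (basis (branch_shift t x)) =
        lin (project T (prime_constraint p)) (lin (\<lambda>x. basis (branch_shift t x))
          (project T (prime_constraint p) x))" for p x
      by (rule comm)
    show "lookup (basis (branch_shift t x)) y \<in> \<int>" for x y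
      by (simp add: lookup_single when_def)
    show "lookup (project T (prime_constraint p) x) y \<in> \<int>" for p x y
      by (rule lookup_project_Ints)
    show "v \<in> prime_group (\<lambda>p. project T (prime_constraint p))"
      using assms(4) by (simp add: tree_vectors_def)
  qed
qed

section \<open>Groups with domain omega\<close>

definition coded_group :: "(nat \<Rightarrow> 'v::ab_group_add) \<Rightarrow> nat monoid" where
  "coded_group c = \<lparr>carrier = UNIV, mult = \<lambda>x y. inv_into UNIV c (c x + c y), one = inv_into UNIV c 0\<rparr>"

locale vector_coding =
  fixes c :: "nat \<Rightarrow> ('a \<Rightarrow>\<^sub>0 rat)" and H :: "('a \<Rightarrow>\<^sub>0 rat) set"
  assumes bij: "bij_betw c UNIV H"
    and zero: "0 \<in> H"
    and add: "\<And>v w. v \<in> H \<Longrightarrow> w \<in> H \<Longrightarrow> v + w \<in> H"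
    and uminus: "\<And>v. v \<in> H \<Longrightarrow> - v \<in> H"
begin

abbreviation G where "G \<equiv> coded_group c"

lemma carrier_coded [simp]: "carrier G = UNIV"
  by (simp add: coded_group_def)

lemma code_in [simp]: "c x \<in> H"
  using bij by (auto simp: bij_betw_def)

lemma code_eq_iff: "c x = c y \<longleftrightarrow> x = y"
  using bij by (auto simp: bij_betw_def inj_on_def)

lemma code_decode [simp]: "v \<in> H \<Longrightarrow> c (inv_into UNIV c v) = v"
  using bij by (auto simp: bij_betw_def intro: f_inv_into_f)

lemma decode_code [simp]: "inv_into UNIV c (c x) = x"
  using bij by (simp add: bij_betw_def)

lemma code_mult [simp]: "c (x \<otimes>\<^bsub>G\<^esub> y) = c x + c y"
  and code_one [simp]: "c \<one>\<^bsub>G\<^esub> = 0"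
  by (simp_all add: coded_group_def zero add)

lemma comm_group: "comm_group G"
proof (rule comm_groupI)
  fix x
  have "inv_into UNIV c (- c x) \<otimes>\<^bsub>G\<^esub> x = \<one>\<^bsub>G\<^esub>"
    unfolding code_eq_iff[symmetric] by (simp add: uminus)
  then show "\<exists>y\<in>carrier G. y \<otimes>\<^bsub>G\<^esub> x = \<one>\<^bsub>G\<^esub>"
    by auto
qed (simp_all flip: code_eq_iff add: algebra_simps)

sublocale comm_group G
  by (rule comm_group)

lemma code_inv [simp]: "c (inv\<^bsub>G\<^esub> x) = - c x"
proof -
  have "c (inv\<^bsub>G\<^esub> x \<otimes>\<^bsub>G\<^esub> x) = c \<one>\<^bsub>G\<^esub>"
    by (simp only: l_inv carrier_coded UNIV_I)
  then have "c (inv\<^bsub>G\<^esub> x) + c x = 0"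
    by (simp only: code_mult code_one)
  then show ?thesis
    by (simp only: eq_neg_iff_add_eq_0)
qed

lemma code_nat_pow [simp]: "c (x [^]\<^bsub>G\<^esub> (n::nat)) = qscale (of_nat n) (c x)"
  by (induction n) (simp_all add: qscale_add_left add.commute)

lemma code_int_pow [simp]: "c (x [^]\<^bsub>G\<^esub> (m::int)) = qscale (of_int m) (c x)"
  by (cases m rule: int_cases2) (simp_all add: int_pow_int int_pow_neg qscale_minus_left)

lemma torsion_free: "torsion_free G"
  unfolding torsion_free_def
proof (intro ballI allI impI)
  fix x and n :: nat
  assume "0 < n" "x [^]\<^bsub>G\<^esub> n = \<one>\<^bsub>G\<^esub>"
  then have "c (x [^]\<^bsub>G\<^esub> n) = c \<one>\<^bsub>G\<^esub>"
    by (simp only:)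
  with \<open>0 < n\<close> have "c x = 0"
    by (simp add: qscale_eq_0_iff)
  then show "x = \<one>\<^bsub>G\<^esub>"
    by (simp flip: code_eq_iff)
qed

lemma additive_on_hom:
  assumes "f \<in> hom G G"
  shows "additive_on H (\<lambda>v. c (f (inv_into UNIV c v)))"
proof -
  have "inv_into UNIV c (v + w) = inv_into UNIV c v \<otimes>\<^bsub>G\<^esub> inv_into UNIV c w" if "v \<in> H" "w \<in> H" for v w
    unfolding code_eq_iff[symmetric] using that by (simp add: add)
  then show ?thesis
    using assms by (simp add: additive_on_def hom_def)
qed

lemma hom_additive_on:
  assumes "additive_on H h"
  shows "(\<lambda>x. inv_into UNIV c (h (c x))) \<in> hom G G"
  using assms by (auto simp: additive_on_def hom_def add simp flip: code_eq_iff)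

lemma endorigid_if_scalar:
  assumes "\<And>h. additive_on H h \<Longrightarrow> \<exists>m::int. \<forall>v\<in>H. h v = qscale (of_int m) v"
  shows "endorigid G"
  unfolding endorigid_def integer_multiplication_def
proof
  fix f
  assume "f \<in> hom G G"
  from assms[OF additive_on_hom[OF this]]
  obtain m :: int where "\<forall>v\<in>H. c (f (inv_into UNIV c v)) = qscale (of_int m) v" ..
  from bspec[OF this code_in] have "f x = x [^]\<^bsub>G\<^esub> m" for x
    by (simp flip: code_eq_iff)
  then show "\<exists>m::int. \<forall>x\<in>carrier G. f x = x [^]\<^bsub>G\<^esub> m"
    by blast
qed

text \<open>If a power of the coset of \<open>x\<close> were trivial, the same power of
  \<open>x\<close> would lie in the image.\<close>

lemma nontorsion_quotient:
  assumes "f \<in> hom G G" "\<And>n::nat. 0 < n \<Longrightarrow> x [^]\<^bsub>G\<^esub> n \<notin> f ` carrier G"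
  shows "\<not> torsion_group (G Mod (f ` carrier G))"
proof
  interpret f: group_hom G G f
    by unfold_locales (rule assms(1))
  let ?N = "f ` carrier G"
  have sub: "subgroup ?N G"
    by (rule f.img_is_subgroup)
  then interpret N: normal ?N G
    by (rule subgroup_imp_normal)
  have q: "(\<lambda>a. ?N #>\<^bsub>G\<^esub> a) \<in> hom G (G Mod ?N)"
    by (rule N.r_coset_hom_Mod)
  interpret q: group_hom G "G Mod ?N" "\<lambda>a. ?N #>\<^bsub>G\<^esub> a"
    by (intro group_hom.intro group_hom_axioms.intro q is_group N.factorgroup_is_group)
  assume "torsion_group (G Mod ?N)"
  moreover have "?N #>\<^bsub>G\<^esub> x \<in> carrier (G Mod ?N)"
    by (rule q.hom_closed) simp
  ultimately obtain n :: nat where n: "0 < n" "(?N #>\<^bsub>G\<^esub> x) [^]\<^bsub>G Mod ?N\<^esub> n = \<one>\<^bsub>G Mod ?N\<^esub>"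
    unfolding torsion_group_def by blast
  then have "?N #>\<^bsub>G\<^esub> (x [^]\<^bsub>G\<^esub> n) = ?N"
    using q.hom_nat_pow[of x n] by simp
  then have "x [^]\<^bsub>G\<^esub> n \<in> ?N"
    by (intro coset_join1[OF _ _ sub]) auto
  with assms(2) n(1) show False
    by blast
qed

text \<open>A single vector \<open>v\<close> refutes both properties: its image is no integer
  multiple of it, and no positive multiple of it is an image.\<close>

lemma additive_witness:
  assumes "additive_on H h" "inj_on h H" "v \<in> H" "\<And>m. h v \<noteq> qscale (of_int m) v"
    and "\<And>n::nat. 0 < n \<Longrightarrow> qscale (of_nat n) v \<notin> h ` H"
  shows "\<exists>f\<in>hom G G. inj_on f (carrier G) \<and> \<not> integer_multiplication G f \<and>
    \<not> torsion_group (G Mod (f ` carrier G))"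
proof (intro bexI conjI)
  let ?f = "\<lambda>x. inv_into UNIV c (h (c x))" and ?x = "inv_into UNIV c v"
  have hH: "h (c x) \<in> H" for x
    using assms(1) by (simp add: additive_on_def)
  show f: "?f \<in> hom G G"
    by (rule hom_additive_on[OF assms(1)])
  show "inj_on ?f (carrier G)"
  proof (rule inj_onI)
    fix x y
    assume "?f x = ?f y"
    then have "c (?f x) = c (?f y)"
      by (rule arg_cong)
    then have "h (c x) = h (c y)"
      by (simp add: hH)
    from inj_onD[OF assms(2) this] show "x = y"
      by (simp add: code_eq_iff)
  qed
  show "\<not> integer_multiplication G ?f"
  proof
    assume "integer_multiplication G ?f"
    then obtain m :: int where "?f ?x = ?x [^]\<^bsub>G\<^esub> m"
      unfolding integer_multiplication_def by auto
    then have "c (?f ?x) = c (?x [^]\<^bsub>G\<^esub> m)"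
      by (rule arg_cong)
    then have "h v = qscale (of_int m) v"
      using hH[of ?x] assms(3) by simp
    with assms(4) show False
      by blast
  qed
  show "\<not> torsion_group (G Mod (?f ` carrier G))"
  proof (rule nontorsion_quotient[OF f, of ?x])
    fix n :: nat
    assume "0 < n"
    show "?x [^]\<^bsub>G\<^esub> n \<notin> ?f ` carrier G"
    proof
      assume "?x [^]\<^bsub>G\<^esub> n \<in> ?f ` carrier G"
      then obtain y where "?x [^]\<^bsub>G\<^esub> n = ?f y"
        by blast
      then have "c (?x [^]\<^bsub>G\<^esub> n) = c (?f y)"
        by (rule arg_cong)
      then have "qscale (of_nat n) v = h (c y)"
        using hH[of y] assms(3) by simp
      with assms(5)[OF \<open>0 < n\<close>] show False
        by auto
    qed
  qed
qed

end

section \<open>Enumeration of the group of a tree by the natural numbers\<close>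

instance poly_mapping :: (countable, "{countable, zero}") countable
proof
  have "\<exists>l. set l = (\<lambda>x. (x, lookup v x)) ` keys v" for v :: "'a \<Rightarrow>\<^sub>0 'b"
    by (rule finite_list) simp
  then obtain f where f: "\<And>v :: 'a \<Rightarrow>\<^sub>0 'b. set (f v) = (\<lambda>x. (x, lookup v x)) ` keys v"
    by metis
  have "inj f"
  proof (rule injI)
    fix v w :: "'a \<Rightarrow>\<^sub>0 'b"
    assume "f v = f w"
    then have eq: "(\<lambda>x. (x, lookup v x)) ` keys v = (\<lambda>x. (x, lookup w x)) ` keys w"
      using f by metis
    show "v = w"
    proof (rule poly_mapping_eqI)
      fix x
      \<comment> \<open>The graph over the support recovers every coefficient, a missing key meaning
        0.\<close>
      have "(x, q) \<in> (\<lambda>x. (x, lookup u x)) ` keys u \<longleftrightarrow> q = lookup u x \<and> q \<noteq> 0"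
        for q and u :: "'a \<Rightarrow>\<^sub>0 'b"
        by (auto simp: in_keys_iff)
      from this[of _ v] this[of _ w] show "lookup v x = lookup w x"
        unfolding eq by metis
    qed
  qed
  then show "\<exists>g :: ('a \<Rightarrow>\<^sub>0 'b) \<Rightarrow> nat. inj g"
    using inj_compose[OF inj_to_nat] by blast
qed

text \<open>One list of all vectors is fixed independently of the tree, and the members of the group
  are taken from it in increasing order of index. In this way each \<open>tree_code T i\<close>
  depends measurably on \<open>T\<close>.\<close>

definition tree_code :: "(nat \<Rightarrow> nat \<Rightarrow> bool) \<Rightarrow> nat \<Rightarrow> (gen \<Rightarrow>\<^sub>0 rat)" where
  "tree_code T i = from_nat_into UNIV (enumerate {j. from_nat_into UNIV j \<in> tree_vectors T} i)"

lemma vector_coding_tree: "vector_coding (tree_code T) (tree_vectors T)"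
proof
  let ?e = "from_nat_into UNIV :: nat \<Rightarrow> (gen \<Rightarrow>\<^sub>0 rat)" and ?J = "{j. from_nat_into UNIV j \<in> tree_vectors T}"
  have "inj (\<lambda>n. basis (Root n))"
    by (auto simp: inj_on_def poly_mapping_eq_iff fun_eq_iff lookup_single when_def split: if_splits)
  then have inf: "infinite (range (\<lambda>n. basis (Root n)))"
    by (simp add: range_inj_infinite)
  then have "infinite (UNIV :: (gen \<Rightarrow>\<^sub>0 rat) set)"
    using finite_subset[OF subset_UNIV] by blast
  then have e: "bij ?e"
    by (intro bij_betw_from_nat_into countableI_type)
  then have img: "?e ` ?J = tree_vectors T"
    using surj_image_vimage_eq[OF bij_is_surj[OF e]] by (simp add: vimage_def)
  have "infinite (tree_vectors T)"
    using inf basis_in_tree_vectors finite_subset[of "range (\<lambda>n. basis (Root n))" "tree_vectors T"] by blast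
  then have "infinite ?J"
    using img finite_imageI by metis
  then have "bij_betw (enumerate ?J) UNIV ?J"
    by (rule bij_enumerate)
  moreover have "bij_betw ?e ?J (tree_vectors T)"
    using bij_betw_subset[OF e subset_UNIV img] .
  ultimately have "bij_betw (?e \<circ> enumerate ?J) UNIV (tree_vectors T)"
    by (rule bij_betw_trans)
  moreover have "tree_code T = ?e \<circ> enumerate ?J"
    by (simp add: fun_eq_iff tree_code_def)
  ultimately show "bij_betw (tree_code T) UNIV (tree_vectors T)"
    by simp
qed (simp_all add: tree_vectors_def prime_group_zero prime_group_add prime_group_uminus)

definition tree_group :: "(nat \<Rightarrow> nat \<Rightarrow> bool) \<Rightarrow> nat monoid" where
  "tree_group T = coded_group (tree_code T)"

lemma endorigid_tree_group:
  assumes "tree T" "well_founded_tree T"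
  shows "endorigid (tree_group T)"
proof -
  interpret vector_coding "tree_code T" "tree_vectors T"
    by (rule vector_coding_tree)
  show ?thesis
    unfolding tree_group_def
    by (rule endorigid_if_scalar) (meson well_founded_additive_scalar[OF assms])
qed

lemma not_rigid_tree_group:
  assumes "tree T" "\<not> well_founded_tree T"
  defines "G \<equiv> tree_group T"
  shows "\<exists>f\<in>hom G G. inj_on f (carrier G) \<and> \<not> integer_multiplication G f \<and>
    \<not> torsion_group (G Mod (f ` carrier G))"
proof -
  interpret vector_coding "tree_code T" "tree_vectors T"
    by (rule vector_coding_tree)
  obtain t where t: "\<And>n. T (t n) (t (Suc n))" "\<And>n. tree_level T (t n) = n"
    using not_well_founded_increasing_sequence[OF assms(1,2)] by metis
  have "inj t"
    by (rule inj_on_inverseI[of _ "tree_level T"]) (rule t(2))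
  then have inj: "inj (branch_shift t)"
    by (rule inj_branch_shift)
  let ?h = "lin (\<lambda>x. basis (branch_shift t x))"
  \<comment> \<open>No generator is shifted to \<open>Root 0\<close>.\<close>
  have Root: "lookup (?h v) (Root 0) = 0" for v
  proof -
    have "branch_shift t x \<noteq> Root 0" for x
      by (cases x) auto
    then show ?thesis
      by (simp add: lookup_lin lookup_single)
  qed
  show ?thesis
    unfolding G_def tree_group_def
  proof (rule additive_witness)
    show "additive_on (tree_vectors T) ?h"
      using branch_shift_tree_vectors[OF assms(1) t] by (simp add: additive_on_def lin_add)
    show "inj_on ?h (tree_vectors T)"
    proof (rule inj_onI, rule poly_mapping_eqI)
      fix v w x
      assume "?h v = ?h w"
      then show "lookup v x = lookup w x"
        using lookup_lin_basis_inj[OF inj] by metis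
    qed
    \<comment> \<open>This vector serves both purposes: it is sent to \<open>Node (t 0) 0\<close>,
      and its positive multiples have a nonzero coefficient at \<open>Root 0\<close>, unlike any
      image.\<close>
    show "basis (Root 0) \<in> tree_vectors T"
      by (rule basis_in_tree_vectors)
    fix m :: int
    have "lookup (?h (basis (Root 0))) (Node (t 0) 0) \<noteq> lookup (qscale (of_int m) (basis (Root 0))) (Node (t 0) 0)"
      by (simp add: lookup_single)
    then show "?h (basis (Root 0)) \<noteq> qscale (of_int m) (basis (Root 0))"
      by metis
  next
    fix n :: nat
    assume "0 < n"
    then have "lookup (qscale (of_nat n) (basis (Root 0))) (Root 0) \<noteq> 0"
      by simp
    with Root show "qscale (of_nat n) (basis (Root 0)) \<notin> ?h ` tree_vectors T"
      by (metis imageE)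
  qed
qed

section \<open>Measurability of the construction\<close>

lemma measurable_compose2_countable:
  fixes g :: "'x \<Rightarrow> 'b::countable" and h :: "'x \<Rightarrow> 'd::countable"
  assumes [measurable]: "g \<in> measurable M (count_space UNIV)" "h \<in> measurable M (count_space UNIV)"
  shows "(\<lambda>x. f (g x) (h x)) \<in> measurable M (count_space UNIV)"
  by (rule measurable_compose_countable[where f = "\<lambda>i x. f i (h x)"]) simp_all

lemma measurable_sum_countable:
  fixes f :: "'i \<Rightarrow> 'x \<Rightarrow> 'b::{countable, comm_monoid_add}"
  assumes "\<And>i. i \<in> A \<Longrightarrow> f i \<in> measurable M (count_space UNIV)"
  shows "(\<lambda>x. \<Sum>i\<in>A. f i x) \<in> measurable M (count_space UNIV)"
  using assms
proof (induction A rule: infinite_finite_induct)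
  case (insert i A)
  then show ?case
    using measurable_compose2_countable[of "f i" M "\<lambda>x. \<Sum>i\<in>A. f i x" "(+)"] by simp
qed simp_all

text \<open>The recursion removes the least element of \<open>S x\<close>, and membership in what
  remains is again measurable in \<open>x\<close>; hence the induction with \<open>S\<close>
  arbitrary.\<close>

lemma measurable_enumerate:
  fixes S :: "'x \<Rightarrow> nat set"
  assumes "\<And>i. Measurable.pred M (\<lambda>x. i \<in> S x)"
  shows "(\<lambda>x. enumerate (S x) n) \<in> measurable M (count_space UNIV)"
  using assms
proof (induction n arbitrary: S)
  case 0
  note [measurable] = 0
  show ?case
    unfolding enumerate_0 by measurable
next
  case (Suc n)
  note [measurable] = Suc.prems
  have "Measurable.pred M (\<lambda>x. i \<in> S x - {LEAST j. j \<in> S x})" for i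
    unfolding Diff_iff singleton_iff by measurable
  then show ?case
    unfolding enumerate_Suc by (rule Suc.IH)
qed

text \<open>Second countability allows measurability into a countable power of \<open>bool\<close>
  to be tested coordinatewise.\<close>

instance bool :: second_countable_topology
proof
  have "open = generate_topology (UNIV :: bool set set)"
    by (auto simp: fun_eq_iff open_discrete intro: generate_topology.Basis)
  then show "\<exists>B :: bool set set. countable B \<and> open = generate_topology B"
    using countableI_type by blast
qed

lemma measurable_borel_bool: "measurable M (borel :: bool measure) = measurable M (count_space UNIV)"
  by (rule measurable_cong_sets) (simp_all add: sets_borel_eq_count_space)

lemma measurable_tree_rel [measurable]: "Measurable.pred trees_omega (\<lambda>T. T s t)"
proof -
  let ?V = "vimage_algebra UNIV (\<lambda>T (s, t). T s t) (borel :: (nat \<times> nat \<Rightarrow> bool) measure)"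
  have "(\<lambda>T (s, t). T s t) \<in> measurable ?V (borel :: (nat \<times> nat \<Rightarrow> bool) measure)"
    by (rule measurable_vimage_algebra1) simp
  then have "(\<lambda>T. T s t) \<in> borel_measurable ?V"
    using measurable_product_then_coordinatewise[of "\<lambda>T (s, t). T s t" ?V "(s, t)"] by simp
  then have "(\<lambda>T. T s t) \<in> borel_measurable trees_omega"
    unfolding trees_omega_def by (rule measurable_restrict_space1)
  then show ?thesis
    by (simp only: measurable_borel_bool)
qed

lemma measurable_tree_level [measurable]:
  "(\<lambda>T. tree_level T t) \<in> measurable trees_omega (count_space UNIV)"
  unfolding tree_level_def by measurable

lemma measurable_level_eq_Suc [measurable]:
  assumes [measurable]: "f \<in> measurable trees_omega (count_space UNIV)"
  shows "Measurable.pred trees_omega (\<lambda>T. f T = Suc (tree_level T s))"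
  by (rule measurable_compose2_countable[where f = "\<lambda>i j. i = Suc j"]) measurable

lemma measurable_tree_parent [measurable]:
  "(\<lambda>T. tree_parent T t) \<in> measurable trees_omega (count_space UNIV)"
  unfolding tree_parent_def by measurable

lemma measurable_gen_level [measurable]:
  "(\<lambda>T. gen_level T x) \<in> measurable trees_omega (count_space UNIV)"
  by (cases x) simp_all

lemma measurable_gen_parent [measurable]:
  "(\<lambda>T. gen_parent T x) \<in> measurable trees_omega (count_space UNIV)"
  by (cases x) (simp_all add: measurable_compose[OF measurable_tree_parent])

lemma measurable_project:
  "(\<lambda>T. project T c x) \<in> measurable trees_omega (count_space UNIV)"
proof (cases c)
  case (Level n)
  show ?thesis
    unfolding Level project.simps by measurable
next
  case (Diagonal n)
  have [measurable]: "(\<lambda>T. - basis (gen_parent T x)) \<in> measurable trees_omega (count_space UNIV)"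
    by (rule measurable_compose[OF measurable_gen_parent]) simp
  show ?thesis
    unfolding Diagonal project.simps by measurable
next
  case (Linked t k)
  show ?thesis
    unfolding Linked project.simps by measurable
qed

text \<open>For fixed \<open>v\<close> and each of countably many primes, the image of
  \<open>v\<close> is a finite sum of measurable functions of \<open>T\<close> with values in a
  countable set, on which every predicate is measurable.\<close>

lemma measurable_tree_vectors [measurable]: "Measurable.pred trees_omega (\<lambda>T. v \<in> tree_vectors T)"
proof -
  have "(\<lambda>T. lin (project T c) v) \<in> measurable trees_omega (count_space UNIV)" for c
    unfolding lin_def
    using measurable_compose[OF measurable_project measurable_count_space]
    by (intro measurable_sum_countable)
  then have [measurable]: "Measurable.pred trees_omega (\<lambda>T. vec_integral p (lin (project T c) v))" for p c
    by (rule measurable_compose[OF _ measurable_count_space])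
  show ?thesis
    unfolding tree_vectors_def prime_group_def mem_Collect_eq by measurable
qed

lemma measurable_tree_code: "(\<lambda>T. tree_code T i) \<in> measurable trees_omega (count_space UNIV)"
  unfolding tree_code_def
  by (rule measurable_compose[OF measurable_enumerate measurable_count_space]) simp

lemma measurable_group_structures:
  assumes "\<And>x. x \<in> space M \<Longrightarrow> carrier (F x) = UNIV"
    and "\<And>a b d. Measurable.pred M (\<lambda>x. a \<otimes>\<^bsub>F x\<^esub> b = d)"
    and "\<And>d. Measurable.pred M (\<lambda>x. \<one>\<^bsub>F x\<^esub> = d)"
  shows "F \<in> measurable M group_structures"
  unfolding group_structures_def
proof (rule measurable_vimage_algebra2)
  show "F \<in> space M \<rightarrow> {G. carrier G = UNIV}"
    using assms(1) by blast
  have "(\<lambda>x. (\<lambda>(a, b, d). a \<otimes>\<^bsub>F x\<^esub> b = d)) \<in> borel_measurable M"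
    by (rule measurable_coordinatewise_then_product) (auto simp: measurable_borel_bool assms(2))
  moreover have "(\<lambda>x. (\<lambda>d. \<one>\<^bsub>F x\<^esub> = d)) \<in> borel_measurable M"
    by (rule measurable_coordinatewise_then_product) (auto simp: measurable_borel_bool assms(3))
  ultimately show "(\<lambda>x. (\<lambda>(a, b, d). a \<otimes>\<^bsub>F x\<^esub> b = d, \<lambda>d. \<one>\<^bsub>F x\<^esub> = d)) \<in> borel_measurable M"
    by (rule borel_measurable_Pair)
qed

lemma measurable_tree_group: "tree_group \<in> measurable trees_omega TFAB_omega"
  unfolding TFAB_omega_def
proof (rule measurable_restrict_space2)
  have "comm_group (tree_group T) \<and> torsion_free (tree_group T)" for T
    using vector_coding.comm_group[OF vector_coding_tree] vector_coding.torsion_free[OF vector_coding_tree]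
    by (simp add: tree_group_def)
  then show "tree_group \<in> space trees_omega \<rightarrow> {G. comm_group G \<and> torsion_free G}"
    by simp
  \<comment> \<open>In terms of codes the graph is an equation between measurable functions with
    countable range; \<open>inv_into\<close> disappears.\<close>
  have mult: "a \<otimes>\<^bsub>tree_group T\<^esub> b = d \<longleftrightarrow> tree_code T a + tree_code T b = tree_code T d" for T a b d
    using vector_coding.code_eq_iff[OF vector_coding_tree, of T "a \<otimes>\<^bsub>tree_group T\<^esub> b" d]
    by (simp add: tree_group_def vector_coding.code_mult[OF vector_coding_tree])
  have one: "\<one>\<^bsub>tree_group T\<^esub> = d \<longleftrightarrow> 0 = tree_code T d" for T d
    using vector_coding.code_eq_iff[OF vector_coding_tree, of T "\<one>\<^bsub>tree_group T\<^esub>" d]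
    by (simp add: tree_group_def vector_coding.code_one[OF vector_coding_tree])
  show "tree_group \<in> measurable trees_omega group_structures"
  proof (rule measurable_group_structures)
    show "carrier (tree_group T) = UNIV" for T
      by (simp add: tree_group_def coded_group_def)
    show "Measurable.pred trees_omega (\<lambda>T. a \<otimes>\<^bsub>tree_group T\<^esub> b = d)" for a b d
      unfolding mult
      by (intro measurable_compose2_countable[where f = "(=)"] measurable_compose2_countable[where f = "(+)"]
          measurable_tree_code)
    show "Measurable.pred trees_omega (\<lambda>T. \<one>\<^bsub>tree_group T\<^esub> = d)" for d
      unfolding one by (rule measurable_compose[OF measurable_tree_code measurable_count_space])
  qed
qed

section \<open>Analytic sets and trees\<close>

text \<open>A Suslin scheme. Instead of being indexed by finite sequences, stage \<open>n\<close>
  takes an infinite sequence and reads its first \<open>n\<close> entries only.\<close>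

definition local_scheme :: "'x measure \<Rightarrow> (nat \<Rightarrow> (nat \<Rightarrow> 'b) \<Rightarrow> 'x set) \<Rightarrow> bool" where
  "local_scheme M Q \<longleftrightarrow> (\<forall>n w. Q n w \<in> sets M) \<and>
    (\<forall>n w w'. (\<forall>i<n. w i = w' i) \<longrightarrow> Q n w = Q n w')"

lemma local_schemeD:
  assumes "local_scheme M Q"
  shows "Q n w \<in> sets M"
    and "(\<And>i. i < n \<Longrightarrow> w i = w' i) \<Longrightarrow> Q n w = Q n w'"
  using assms unfolding local_scheme_def by simp_all

text \<open>Here \<open>y\<close> is the point of the Baire space that is projected away in the end,
  and \<open>z\<close> is the auxiliary sequence of the Suslin operation. Both are read to the same
  depth, so that they can be merged into one sequence.\<close>

definition suslin_rep ::
  "'x measure \<Rightarrow> (nat \<Rightarrow> (nat \<Rightarrow> nat) \<Rightarrow> (nat \<Rightarrow> nat) \<Rightarrow> 'x set) \<Rightarrow> ('x \<times> (nat \<Rightarrow> nat)) set \<Rightarrow> bool"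
  where
  "suslin_rep M Q B \<longleftrightarrow> (\<forall>n y z. Q n y z \<in> sets M) \<and>
    (\<forall>n y y' z z'. (\<forall>i<n. y i = y' i) \<longrightarrow> (\<forall>i<n. z i = z' i) \<longrightarrow> Q n y z = Q n y' z') \<and>
    (\<forall>x y. x \<in> space M \<longrightarrow> ((x, y) \<in> B \<longleftrightarrow> (\<exists>z. \<forall>n. x \<in> Q n y z)))"

definition suslin :: "'x measure \<Rightarrow> ('x \<times> (nat \<Rightarrow> nat)) set \<Rightarrow> bool" where
  "suslin M B \<longleftrightarrow> (\<exists>Q. suslin_rep M Q B)"

lemma suslinI:
  fixes Q :: "nat \<Rightarrow> (nat \<Rightarrow> nat) \<Rightarrow> (nat \<Rightarrow> nat) \<Rightarrow> 'x set"
  assumes "\<And>n y z. Q n y z \<in> sets M"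
    and "\<And>n y y' z z'. (\<And>i. i < n \<Longrightarrow> y i = y' i) \<Longrightarrow> (\<And>i. i < n \<Longrightarrow> z i = z' i) \<Longrightarrow> Q n y z = Q n y' z'"
    and "\<And>x y. x \<in> space M \<Longrightarrow> (x, y) \<in> B \<longleftrightarrow> (\<exists>z. \<forall>n. x \<in> Q n y z)"
  shows "suslin M B"
  unfolding suslin_def suslin_rep_def
proof (intro exI[of _ Q] conjI allI impI)
  show "Q n y z = Q n y' z'" if "\<forall>i<n. y i = y' i" "\<forall>i<n. z i = z' i" for n y y' z z'
    by (rule assms(2)) (simp_all add: that)
qed (rule assms(1), rule assms(3))

lemma suslin_repD:
  assumes "suslin_rep M Q B"
  shows "Q n y z \<in> sets M"
    and "(\<And>i. i < n \<Longrightarrow> y i = y' i) \<Longrightarrow> (\<And>i. i < n \<Longrightarrow> z i = z' i) \<Longrightarrow> Q n y z = Q n y' z'"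
    and "x \<in> space M \<Longrightarrow> (x, y) \<in> B \<longleftrightarrow> (\<exists>z. \<forall>n. x \<in> Q n y z)"
  using assms unfolding suslin_rep_def by simp_all

lemma suslin_family:
  assumes "\<And>i::nat. suslin M (B i)"
  obtains Q where "\<And>i. suslin_rep M (Q i) (B i)"
proof -
  have "\<forall>i. \<exists>Q. suslin_rep M Q (B i)"
    using assms by (simp add: suslin_def)
  then have "\<exists>Q. \<forall>i. suslin_rep M (Q i) (B i)"
    by (rule choice)
  with that show thesis
    by blast
qed

text \<open>The first entry of the auxiliary sequence names the index of a set, and the other
  entries are the witness for it. At depth 0 the index cannot be read yet, whence
  \<open>space M\<close>.\<close>

lemma suslin_Union:
  assumes "\<And>i::nat. suslin M (B i)"
  shows "suslin M (\<Union>i. B i)"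
proof -
  obtain Q where "\<And>i. suslin_rep M (Q i) (B i)"
    using suslin_family[of M B] assms by blast
  note Q = suslin_repD[OF this]
  let ?Q = "\<lambda>n y z. case n of 0 \<Rightarrow> space M | Suc m \<Rightarrow> Q (z 0) m y (\<lambda>i. z (Suc i))"
  show ?thesis
  proof (rule suslinI[of ?Q])
    show "?Q n y z \<in> sets M" for n y z
      using Q(1) by (auto split: nat.split)
    show "?Q n y z = ?Q n y' z'"
      if "\<And>i. i < n \<Longrightarrow> y i = y' i" "\<And>i. i < n \<Longrightarrow> z i = z' i" for n y y' z z'
    proof (cases n)
      case (Suc m)
      have "Q (z' 0) m y (\<lambda>i. z (Suc i)) = Q (z' 0) m y' (\<lambda>i. z' (Suc i))"
        by (rule Q(2)) (simp_all add: that Suc)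
      with Suc that(2)[of 0] show ?thesis
        by simp
    qed simp
    fix x y
    assume x: "x \<in> space M"
    show "(x, y) \<in> (\<Union>i. B i) \<longleftrightarrow> (\<exists>z. \<forall>n. x \<in> ?Q n y z)"
    proof
      assume "(x, y) \<in> (\<Union>i. B i)"
      then obtain i z where "\<forall>n. x \<in> Q i n y z"
        using Q(3)[OF x] by auto
      then have "\<forall>n. x \<in> ?Q n y (case_nat i z)"
        using x by (auto split: nat.split)
      then show "\<exists>z. \<forall>n. x \<in> ?Q n y z"
        by (rule exI[where x = "case_nat i z"])
    next
      assume "\<exists>z. \<forall>n. x \<in> ?Q n y z"
      then obtain z where z: "\<forall>n. x \<in> ?Q n y z" ..
      have "x \<in> Q (z 0) n y (\<lambda>i. z (Suc i))" for n
        using spec[OF z, of "Suc n"] by simp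
      then have "(x, y) \<in> B (z 0)"
        using Q(3)[OF x] by blast
      then show "(x, y) \<in> (\<Union>i. B i)"
        by blast
    qed
  qed
qed

text \<open>A single auxiliary sequence codes the witnesses for all the sets through
  \<open>prod_encode\<close>.\<close>

lemma suslin_Inter:
  assumes "\<And>i::nat. suslin M (B i)"
  shows "suslin M (\<Inter>i. B i)"
proof -
  obtain Q where "\<And>i. suslin_rep M (Q i) (B i)"
    using suslin_family[of M B] assms by blast
  note Q = suslin_repD[OF this]
  \<comment> \<open>These are the pairs for which stage \<open>m\<close> of the scheme with index
    \<open>i\<close> can be computed from the first \<open>n\<close> entries of \<open>y\<close> and
    \<open>z\<close>. Every \<open>(i, 0)\<close> belongs to the set, so the intersection is
    countable rather than finite.\<close>
  define I where "I n = {(i, m). m \<le> n \<and> (\<forall>j<m. prod_encode (i, j) < n)}" for n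
  let ?Q = "\<lambda>n y z. \<Inter>(i, m)\<in>I n. Q i m y (\<lambda>j. z (prod_encode (i, j)))"
  show ?thesis
  proof (rule suslinI[of ?Q])
    \<comment> \<open>An empty intersection would be the whole type instead of a measurable
      set.\<close>
    have "(0, 0) \<in> I n" for n
      by (simp add: I_def)
    then have "I n \<noteq> {}" for n
      by (metis empty_iff)
    then show "?Q n y z \<in> sets M" for n y z
      using Q(1) by (intro sets.countable_INT') auto
    show "?Q n y z = ?Q n y' z'"
      if "\<And>i. i < n \<Longrightarrow> y i = y' i" "\<And>i. i < n \<Longrightarrow> z i = z' i" for n y y' z z'
    proof (rule INF_cong[OF refl])
      fix p
      assume "p \<in> I n"
      then obtain i m where p: "p = (i, m)" "m \<le> n" "\<forall>j<m. prod_encode (i, j) < n"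
        by (auto simp: I_def)
      have "Q i m y (\<lambda>j. z (prod_encode (i, j))) = Q i m y' (\<lambda>j. z' (prod_encode (i, j)))"
        by (rule Q(2)) (use p that in simp_all)
      then show "(case p of (i, m) \<Rightarrow> Q i m y (\<lambda>j. z (prod_encode (i, j)))) =
          (case p of (i, m) \<Rightarrow> Q i m y' (\<lambda>j. z' (prod_encode (i, j))))"
        by (simp add: p(1))
    qed
    fix x y
    assume x: "x \<in> space M"
    show "(x, y) \<in> (\<Inter>i. B i) \<longleftrightarrow> (\<exists>z. \<forall>n. x \<in> ?Q n y z)"
    proof
      assume "(x, y) \<in> (\<Inter>i. B i)"
      then have "\<forall>i. \<exists>z. \<forall>n. x \<in> Q i n y z"
        using Q(3)[OF x] by auto
      then obtain z where z: "\<forall>i n. x \<in> Q i n y (z i)"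
        using choice[of "\<lambda>i z. \<forall>n. x \<in> Q i n y z"] by auto
      have "x \<in> ?Q n y (\<lambda>k. case prod_decode k of (i, j) \<Rightarrow> z i j)" for n
        using z by auto
      then show "\<exists>z. \<forall>n. x \<in> ?Q n y z"
        by (intro exI allI)
    next
      assume "\<exists>z. \<forall>n. x \<in> ?Q n y z"
      then obtain z where z: "\<forall>n. x \<in> ?Q n y z" ..
      have "x \<in> Q i m y (\<lambda>j. z (prod_encode (i, j)))" for i m
      proof -
        have "finite ((\<lambda>j. prod_encode (i, j)) ` {..<m})"
          by simp
        then obtain n where n: "\<forall>k\<in>(\<lambda>j. prod_encode (i, j)) ` {..<m}. k < n"
          unfolding finite_nat_set_iff_bounded by blast
        have "(i, m) \<in> I (max m n)"
          using n by (auto simp: I_def less_max_iff_disj)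
        with spec[OF z, of "max m n"] show ?thesis
          by auto
      qed
      then have "(x, y) \<in> B i" for i
        using Q(3)[OF x] by blast
      then show "(x, y) \<in> (\<Inter>i. B i)"
        by blast
    qed
  qed
qed

lemma suslin_rectangle:
  assumes "A \<in> sets M"
  shows "suslin M (A \<times> UNIV)"
  by (rule suslinI[of "\<lambda>n y z. A"]) (use assms in auto)

text \<open>The decision is postponed to the stages \<open>n > i\<close>, which are the ones allowed
  to read \<open>y i\<close>.\<close>

lemma suslin_coordinate: "suslin M {p \<in> space M \<times> UNIV. P (snd p i)}"
  by (rule suslinI[of "\<lambda>n y z. if i < n \<and> \<not> P (y i) then {} else space M"]) auto

lemma suslin_cong:
  assumes "suslin M A" "A \<inter> space M \<times> UNIV = B \<inter> space M \<times> UNIV"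
  shows "suslin M B"
proof -
  have "(x, y) \<in> A \<longleftrightarrow> (x, y) \<in> B" if "x \<in> space M" for x y
    using assms(2) that by blast
  with assms(1) show ?thesis
    unfolding suslin_def suslin_rep_def by simp
qed

text \<open>The class \<open>C\<close> of sets that are \<open>suslin\<close> together with their
  complements is a sigma-algebra, since countable unions and intersections preserve
  \<open>suslin\<close>. It makes both projections measurable.\<close>

lemma borel_imp_suslin:
  assumes B: "B \<in> sets (M \<Otimes>\<^sub>M (borel :: (nat \<Rightarrow> nat) measure))"
  shows "suslin M B"
proof -
  let ?O = "space M \<times> (UNIV :: (nat \<Rightarrow> nat) set)"
  define C where "C = {B. B \<subseteq> ?O \<and> suslin M B \<and> suslin M (?O - B)}"
  interpret C: sigma_algebra ?O C
    unfolding sigma_algebra_iff2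
  proof (intro conjI ballI allI impI)
    show "C \<subseteq> Pow ?O"
      by (auto simp: C_def)
    show "{} \<in> C"
      using suslin_rectangle[of "{}" M] suslin_rectangle[of "space M" M] by (simp add: C_def)
    show "?O - A \<in> C" if "A \<in> C" for A
      using that by (simp add: C_def double_diff)
    fix A :: "nat \<Rightarrow> ('a \<times> (nat \<Rightarrow> nat)) set"
    assume "range A \<subseteq> C"
    then have A: "A i \<subseteq> ?O" "suslin M (A i)" "suslin M (?O - A i)" for i
      by (auto simp: C_def)
    have "suslin M (?O - (\<Union>i. A i))"
      using suslin_Inter[OF A(3)] by (rule suslin_cong) auto
    then show "(\<Union>i. A i) \<in> C"
      using A(1) suslin_Union[OF A(2)] by (auto simp: C_def)
  qed
  define N where "N = sigma ?O C"
  have N: "space N = ?O" "sets N = C"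
    by (simp_all add: N_def C.sets_measure_of_eq C.space_measure_of_eq)
  have 1: "fst \<in> measurable N M"
  proof (rule measurableI)
    fix A
    assume A: "A \<in> sets M"
    have "fst -` A \<inter> ?O = A \<times> UNIV" "?O - A \<times> UNIV = (space M - A) \<times> UNIV"
      using sets.sets_into_space[OF A] by auto
    with A show "fst -` A \<inter> space N \<in> sets N"
      unfolding N C_def
      using suslin_rectangle[of A M] suslin_rectangle[of "space M - A" M] sets.sets_into_space[OF A]
      by auto
  qed (auto simp: N)
  have "(\<lambda>p. snd p i) \<in> measurable N (count_space UNIV)" for i
  proof (rule measurableI)
    fix K :: "nat set"
    have "(\<lambda>p. snd p i) -` K \<inter> ?O = {p \<in> ?O. snd p i \<in> K}"
      "?O - {p \<in> ?O. snd p i \<in> K} = {p \<in> ?O. snd p i \<notin> K}"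
      by auto
    then show "(\<lambda>p. snd p i) -` K \<inter> space N \<in> sets N"
      unfolding N C_def
      using suslin_coordinate[of M "\<lambda>k. k \<in> K" i] suslin_coordinate[of M "\<lambda>k. k \<notin> K" i]
      by auto
  qed simp
  moreover have "measurable N (borel :: nat measure) = measurable N (count_space UNIV)"
    by (rule measurable_cong_sets) (simp_all add: sets_borel_eq_count_space)
  ultimately have "(\<lambda>p. snd p i) \<in> borel_measurable N" for i
    by simp
  then have "snd \<in> borel_measurable N"
    by (rule measurable_coordinatewise_then_product)
  \<comment> \<open>This is the identity map, so every set of the product sigma-algebra belongs to
    \<open>C\<close>.\<close>
  with 1 have "(\<lambda>p. (fst p, snd p)) \<in> measurable N (M \<Otimes>\<^sub>M borel)"
    by (rule measurable_Pair)
  from measurable_sets[OF this B] have "B \<inter> ?O \<in> C"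
    by (simp add: N)
  then show ?thesis
    unfolding C_def by (auto intro: suslin_cong[of M "B \<inter> ?O"])
qed

text \<open>Projecting adds a quantifier over \<open>y\<close>, which is merged with the one over
  \<open>z\<close> by pairing the sequences entry by entry.\<close>

lemma analytic_set_scheme:
  assumes "analytic_set M A"
  obtains P :: "nat \<Rightarrow> (nat \<Rightarrow> nat) \<Rightarrow> 'x set"
    where "local_scheme M P" "\<forall>x\<in>space M. x \<in> A \<longleftrightarrow> (\<exists>w. \<forall>n. x \<in> P n w)"
proof -
  obtain B where B: "B \<in> sets (M \<Otimes>\<^sub>M (borel :: (nat \<Rightarrow> nat) measure))" "A = fst ` B"
    using assms unfolding analytic_set_def by blast
  obtain Q where "suslin_rep M Q B"
    using borel_imp_suslin[OF B(1)] unfolding suslin_def ..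
  note Q = suslin_repD[OF this]
  let ?P = "\<lambda>n w. Q n (\<lambda>i. fst (prod_decode (w i))) (\<lambda>i. snd (prod_decode (w i)))"
  have "local_scheme M ?P"
    unfolding local_scheme_def
  proof (intro conjI allI impI)
    show "?P n w \<in> sets M" for n w
      by (rule Q(1))
    show "?P n w = ?P n w'" if "\<forall>i<n. w i = w' i" for n w w'
      by (rule Q(2)) (simp_all add: that)
  qed
  moreover have "\<forall>x\<in>space M. x \<in> A \<longleftrightarrow> (\<exists>w. \<forall>n. x \<in> ?P n w)"
  proof
    fix x
    assume x: "x \<in> space M"
    have "x \<in> A \<longleftrightarrow> (\<exists>y. (x, y) \<in> B)"
      by (force simp: B(2))
    also have "\<dots> \<longleftrightarrow> (\<exists>y z. \<forall>n. x \<in> Q n y z)"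
      by (simp only: Q(3)[OF x])
    also have "\<dots> \<longleftrightarrow> (\<exists>w. \<forall>n. x \<in> ?P n w)"
    proof
      assume "\<exists>y z. \<forall>n. x \<in> Q n y z"
      then obtain y z where "\<forall>n. x \<in> Q n y z"
        by (elim exE)
      then have "\<forall>n. x \<in> ?P n (\<lambda>i. prod_encode (y i, z i))"
        by simp
      then show "\<exists>w. \<forall>n. x \<in> ?P n w"
        by (rule exI[where x = "\<lambda>i. prod_encode (y i, z i)"])
    qed (elim exE, intro exI)
    finally show "x \<in> A \<longleftrightarrow> (\<exists>w. \<forall>n. x \<in> ?P n w)" .
  qed
  ultimately show thesis
    by (rule that)
qed

section \<open>The tree of finite sequences attached to a point by a scheme\<close>

text \<open>For a local scheme the codes of rejected sequences become isolated nodes, so that the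
  domain stays all of \<open>nat\<close>, and stage \<open>k\<close> never depends on
  \<open>(!)\<close> beyond the end of the list.\<close>

definition scheme_tree :: "(nat \<Rightarrow> (nat \<Rightarrow> nat) \<Rightarrow> 'x set) \<Rightarrow> 'x \<Rightarrow> nat \<Rightarrow> nat \<Rightarrow> bool" where
  "scheme_tree P x a b \<longleftrightarrow> strict_prefix (list_decode a) (list_decode b) \<and>
    (\<forall>k\<le>length (list_decode b). x \<in> P k ((!) (list_decode b)))"

lemma local_scheme_prefix:
  assumes "local_scheme M P" "prefix u v" "k \<le> length u"
  shows "P k ((!) u) = P k ((!) v)"
proof -
  have "u ! i = v ! i" if "i < k" for i
    using assms(2,3) that by (auto simp: prefix_def nth_append)
  then show ?thesis
    by (rule local_schemeD(2)[OF assms(1)])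
qed

lemma tree_scheme_tree:
  assumes "local_scheme M P"
  shows "tree (scheme_tree P x)"
  unfolding tree_def
proof (intro conjI allI)
  let ?T = "scheme_tree P x"
  show "irreflp ?T"
    by (simp add: irreflp_def scheme_tree_def)
  show "transp ?T"
    unfolding transp_def scheme_tree_def using prefix_order.less_trans by blast
  fix t
  show "finite {s. ?T s t}"
  proof (rule finite_subset)
    show "{s. ?T s t} \<subseteq> list_encode ` set (prefixes (list_decode t))"
    proof
      fix s
      assume "s \<in> {s. ?T s t}"
      then have "list_decode s \<in> set (prefixes (list_decode t))"
        by (simp add: scheme_tree_def strict_prefix_def)
      then have "list_encode (list_decode s) \<in> list_encode ` set (prefixes (list_decode t))"
        by (rule imageI)
      then show "s \<in> list_encode ` set (prefixes (list_decode t))"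
        by simp
    qed
  qed simp
  \<comment> \<open>Acceptance passes to initial segments, so among the predecessors of
    \<open>t\<close> the order is the prefix order.\<close>
  have below: "?T r s" if "?T s t" "strict_prefix (list_decode r) (list_decode s)" for r s
  proof -
    have p: "prefix (list_decode s) (list_decode t)"
      using that(1) by (simp add: scheme_tree_def strict_prefix_def)
    have "x \<in> P k ((!) (list_decode s))" if "k \<le> length (list_decode s)" for k
      using local_scheme_prefix[OF assms p that] \<open>?T s t\<close> prefix_length_le[OF p] that
      by (simp add: scheme_tree_def)
    with that(2) show ?thesis
      by (simp add: scheme_tree_def)
  qed
  show "totalp_on {s. ?T s t} ?T"
  proof (rule totalp_onI)
    fix r s
    assume rs: "r \<in> {s. ?T s t}" "s \<in> {s. ?T s t}" "r \<noteq> s"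
    then have "list_decode r \<noteq> list_decode s"
      using inj_onD[OF inj_list_decode] by blast
    moreover have "prefix (list_decode r) (list_decode s) \<or> prefix (list_decode s) (list_decode r)"
      by (rule prefix_same_cases[of _ "list_decode t"]) (use rs in \<open>auto simp: scheme_tree_def\<close>)
    ultimately show "?T r s \<or> ?T s r"
      using below rs(1,2) by (auto simp: strict_prefix_def)
  qed
  show "wfp_on {s. ?T s t} ?T"
    by (rule wfp_on_subset[OF wfp_if_convertible_to_nat[of ?T "\<lambda>s. length (list_decode s)"]])
      (auto simp: scheme_tree_def dest: prefix_length_less)
qed

text \<open>An increasing sequence of nodes consists of accepted lists of unbounded length that
  extend one another, and their limit is \<open>w\<close>. Conversely the initial segments of
  \<open>w\<close> form such a sequence.\<close>

lemma well_founded_scheme_tree: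
  assumes "local_scheme M P"
  shows "\<not> well_founded_tree (scheme_tree P x) \<longleftrightarrow> (\<exists>w. \<forall>n. x \<in> P n w)"
proof
  let ?T = "scheme_tree P x"
  assume "\<not> well_founded_tree ?T"
  then obtain t where t: "\<And>n. ?T (t n) (t (Suc n))"
    using not_well_founded_increasing_sequence[OF tree_scheme_tree[OF assms, of x]] by metis
  define l where "l n = list_decode (t n)" for n
  have pre: "prefix (l m) (l n)" if "m \<le> n" for m n
    using that
  proof (induction rule: dec_induct)
    case (step n)
    then show ?case
      using t[of n] unfolding scheme_tree_def l_def by (auto intro: prefix_order.trans)
  qed simp
  have len: "n \<le> length (l n)" for n
  proof (induction n)
    case (Suc n)
    then show ?case
      using t[of n] prefix_length_less[of "l n" "l (Suc n)"] by (simp add: scheme_tree_def l_def)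
  qed simp
  \<comment> \<open>The list \<open>l (Suc i)\<close> has length at least \<open>i + 1\<close>, so
    it already contains entry \<open>i\<close> of the limit.\<close>
  have "x \<in> P n (\<lambda>i. l (Suc i) ! i)" for n
  proof -
    have "l (Suc i) ! i = l (Suc n) ! i" if "i < n" for i
      using pre[of "Suc i" "Suc n"] len[of "Suc i"] that by (auto simp: prefix_def nth_append)
    then have "P n (\<lambda>i. l (Suc i) ! i) = P n ((!) (l (Suc n)))"
      by (rule local_schemeD(2)[OF assms])
    then show ?thesis
      using t[of n] len[of "Suc n"] by (simp add: scheme_tree_def l_def)
  qed
  then show "\<exists>w. \<forall>n. x \<in> P n w"
    by blast
next
  assume "\<exists>w. \<forall>n. x \<in> P n w"
  then obtain w where w: "\<And>n. x \<in> P n w"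
    by blast
  show "\<not> well_founded_tree (scheme_tree P x)"
  proof (rule increasing_sequence_not_well_founded[OF tree_scheme_tree[OF assms]])
    fix n
    have "P k ((!) (map w [0..<Suc n])) = P k w" if "k \<le> Suc n" for k
    proof -
      have "map w [0..<Suc n] ! i = w i" if "i < k" for i
        using that \<open>k \<le> Suc n\<close> by (simp del: upt_Suc)
      then show ?thesis
        by (rule local_schemeD(2)[OF assms])
    qed
    then show "scheme_tree P x (list_encode (map w [0..<n])) (list_encode (map w [0..<Suc n]))"
      using w by (simp add: scheme_tree_def strict_prefix_def)
  qed
qed

lemma measurable_scheme_tree:
  assumes "local_scheme M P"
  shows "scheme_tree P \<in> measurable M trees_omega"
  unfolding trees_omega_def
proof (rule measurable_restrict_space2[OF _ measurable_vimage_algebra2])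
  show "scheme_tree P \<in> space M \<rightarrow> {T. tree T}"
    by (simp add: tree_scheme_tree[OF assms])
  show "(\<lambda>x (s, t). scheme_tree P x s t) \<in> borel_measurable M"
  proof (rule measurable_coordinatewise_then_product)
    fix p :: "nat \<times> nat"
    have [measurable]: "P k v \<in> sets M" for k v
      using assms by (simp add: local_scheme_def)
    have "Measurable.pred M (\<lambda>x. scheme_tree P x (fst p) (snd p))"
      unfolding scheme_tree_def by measurable
    then show "(\<lambda>x. case p of (s, t) \<Rightarrow> scheme_tree P x s t) \<in> borel_measurable M"
      by (simp add: measurable_borel_bool case_prod_beta)
  qed
qed simp

section \<open>The standard Borel space of torsion-free abelian groups\<close>

lemma second_countable_euclidean:
  "second_countable (euclidean :: 'a::second_countable_topology topology)"
proof -
  obtain B :: "'a set set" where "countable B" "topological_basis B"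
    using ex_countable_basis by blast
  show ?thesis
    unfolding second_countable_def
  proof (intro exI[of _ B] conjI ballI allI impI)
    show "countable B"
      by fact
    show "openin euclidean V" if "V \<in> B" for V
      using topological_basis_open[OF \<open>topological_basis B\<close> that] by simp
    fix U and x :: 'a
    assume "openin euclidean U \<and> x \<in> U"
    then have U: "open U" "x \<in> U"
      by simp_all
    obtain V where "V \<in> B" "x \<in> V" "V \<subseteq> U"
      by (rule topological_basisE[OF \<open>topological_basis B\<close> U])
    then show "\<exists>V\<in>B. x \<in> V \<and> V \<subseteq> U"
      by blast
  qed
qed

lemma completely_metrizable_space_euclidean_nat: "completely_metrizable_space (euclidean :: nat topology)"
proof -
  have "(euclidean :: nat topology) = discrete_topology UNIV"
    by (simp add: topology_eq open_discrete)
  then show ?thesis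
    by (simp add: completely_metrizable_space_discrete_topology)
qed

lemma completely_metrizable_space_euclidean_operations:
  "completely_metrizable_space (euclidean :: ((nat \<times> nat \<Rightarrow> nat) \<times> nat) topology)"
proof -
  have "completely_metrizable_space (product_topology (\<lambda>_. euclidean) UNIV :: (nat \<times> nat \<Rightarrow> nat) topology)"
    by (simp add: completely_metrizable_space_product_topology completely_metrizable_space_euclidean_nat)
  then have "completely_metrizable_space (euclidean :: (nat \<times> nat \<Rightarrow> nat) topology)"
    by (simp only: euclidean_product_topology)
  then have "completely_metrizable_space (prod_topology (euclidean :: (nat \<times> nat \<Rightarrow> nat) topology) (euclidean :: nat topology))"
    unfolding completely_metrizable_space_prod_topology
    using completely_metrizable_space_euclidean_nat by blast
  then show ?thesis
    by simp
qed

section \<open>Axioms of torsion-free abelian groups as a G-delta condition\<close>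

definition locally_constant :: "('a::topological_space \<Rightarrow> 'b) \<Rightarrow> bool" where
  "locally_constant f \<longleftrightarrow> (\<forall>k. open {p. f p = k})"

lemma locally_constant_const: "locally_constant (\<lambda>_. c)"
  by (simp add: locally_constant_def)

lemma locally_constant_open:
  assumes "locally_constant f" "locally_constant g"
  shows "open {p. P (f p) (g p)}"
proof -
  have "{p. P (f p) (g p)} = (\<Union>(k, l)\<in>{(k, l). P k l}. {p. f p = k} \<inter> {p. g p = l})"
    by auto
  also have "open \<dots>"
    using assms by (intro open_UN ballI) (auto simp: locally_constant_def intro!: open_Int)
  finally show ?thesis .
qed

text \<open>Near a point both arguments are constant, and evaluation of the operation at fixed
  arguments is locally constant.\<close>

lemma locally_constant_apply:
  fixes f g :: "((nat \<times> nat \<Rightarrow> nat) \<times> 'c::topological_space) \<Rightarrow> nat"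
  assumes "locally_constant f" "locally_constant g"
  shows "locally_constant (\<lambda>p. fst p (f p, g p))"
  unfolding locally_constant_def
proof
  fix k
  have "open {p :: (nat \<times> nat \<Rightarrow> nat) \<times> 'c. fst p a = k}" for a
  proof -
    have "open ((\<lambda>p :: (nat \<times> nat \<Rightarrow> nat) \<times> 'c. fst p a) -` {k})"
      by (intro open_vimage open_discrete continuous_intros
          continuous_on_compose2[OF continuous_on_product_coordinates]) auto
    then show ?thesis
      by (simp add: vimage_def)
  qed
  moreover have "{p. fst p (f p, g p) = k} =
      (\<Union>a. \<Union>b. {p. fst p (a, b) = k} \<inter> {p. f p = a} \<inter> {p. g p = b})"
    by auto
  ultimately show "open {p. fst p (f p, g p) = k}"
    using assms by (auto simp: locally_constant_def intro!: open_UN open_Int)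
qed

lemma locally_constant_snd: "locally_constant (snd :: ('a::topological_space \<times> nat) \<Rightarrow> nat)"
proof -
  have "open (snd -` {k} :: ('a \<times> nat) set)" for k
    by (intro open_vimage open_discrete continuous_intros)
  then show ?thesis
    by (simp add: locally_constant_def vimage_def)
qed

lemma gdelta_Collect_all:
  fixes P :: "'i::countable \<Rightarrow> 'a::topological_space \<Rightarrow> bool"
  assumes "\<And>i. gdelta_in euclidean {p. P i p}"
  shows "gdelta_in euclidean {p. \<forall>i. P i p}"
proof -
  have "gdelta_in euclidean (\<Inter>(range (\<lambda>i. {p. P i p})))"
    using assms by (intro gdelta_in_Inter) auto
  also have "\<Inter>(range (\<lambda>i. {p. P i p})) = {p. \<forall>i. P i p}"
    by auto
  finally show ?thesis .
qed

lemma gdelta_Collect_conj: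
  assumes "gdelta_in euclidean {p. P p}" "gdelta_in euclidean {p. Q p}"
  shows "gdelta_in euclidean {p. P p \<and> Q p}"
  using gdelta_in_Int[OF assms] by (simp add: Collect_conj_eq)

text \<open>Operations and constants replace their graphs because such pairs are already the points
  of a Polish space. In the last clause \<open>Suc n\<close> runs through the positive
  exponents.\<close>

definition tfab_operations :: "((nat \<times> nat \<Rightarrow> nat) \<times> nat) set" where
  "tfab_operations = {p.
    (\<forall>x y z. fst p (fst p (x, y), z) = fst p (x, fst p (y, z))) \<and>
    (\<forall>x. fst p (snd p, x) = x) \<and>
    (\<forall>x y. fst p (x, y) = fst p (y, x)) \<and>
    (\<forall>x. \<exists>y. fst p (y, x) = snd p) \<and>
    (\<forall>x n. ((\<lambda>z. fst p (z, x)) ^^ Suc n) (snd p) = snd p \<longrightarrow> x = snd p)}"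

text \<open>For fixed arguments each axiom is open: it is an equation or implication between locally
  constant terms or, for inverses, a union of such equations. The outer quantifiers are countable
  intersections.\<close>

lemma gdelta_tfab_operations: "gdelta_in euclidean tfab_operations"
proof -
  note lc = locally_constant_const locally_constant_apply locally_constant_snd
  have pow: "locally_constant (\<lambda>p :: (nat \<times> nat \<Rightarrow> nat) \<times> nat. ((\<lambda>z. fst p (z, x)) ^^ n) (snd p))" for x n
    by (induction n) (simp_all add: lc)
  have assoc: "open {p :: (nat \<times> nat \<Rightarrow> nat) \<times> nat. fst p (fst p (x, y), z) = fst p (x, fst p (y, z))}" for x y z
    by (intro locally_constant_open[where P = "(=)"] lc)
  have unit: "open {p :: (nat \<times> nat \<Rightarrow> nat) \<times> nat. fst p (snd p, x) = x}" for x
    by (intro locally_constant_open[where P = "(=)"] lc)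
  have comm: "open {p :: (nat \<times> nat \<Rightarrow> nat) \<times> nat. fst p (x, y) = fst p (y, x)}" for x y
    by (intro locally_constant_open[where P = "(=)"] lc)
  have "open {p :: (nat \<times> nat \<Rightarrow> nat) \<times> nat. fst p (y, x) = snd p}" for x y
    by (intro locally_constant_open[where P = "(=)"] lc)
  then have inv: "open {p :: (nat \<times> nat \<Rightarrow> nat) \<times> nat. \<exists>y. fst p (y, x) = snd p}" for x
    by (intro open_Collect_ex)
  have tf: "open {p :: (nat \<times> nat \<Rightarrow> nat) \<times> nat.
      ((\<lambda>z. fst p (z, x)) ^^ Suc n) (snd p) = snd p \<longrightarrow> x = snd p}" for x n
    by (rule locally_constant_open[where P = "\<lambda>a b. a = b \<longrightarrow> x = b"]) (rule pow, rule lc)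
  show ?thesis
    unfolding tfab_operations_def
    by (intro gdelta_Collect_conj gdelta_Collect_all open_imp_gdelta_in)
      (simp_all only: open_openin[symmetric] assoc unit comm inv tf)
qed

section \<open>Group structures as points of a Polish space\<close>

definition group_operations :: "nat monoid \<Rightarrow> (nat \<times> nat \<Rightarrow> nat) \<times> nat" where
  "group_operations G = (\<lambda>(x, y). x \<otimes>\<^bsub>G\<^esub> y, \<one>\<^bsub>G\<^esub>)"

lemma nat_pow_eq_funpow: "x [^]\<^bsub>G\<^esub> (n::nat) = ((\<lambda>z. z \<otimes>\<^bsub>G\<^esub> x) ^^ n) \<one>\<^bsub>G\<^esub>"
  by (induction n) simp_all

lemma space_TFAB_omega: "space TFAB_omega = {G. carrier G = UNIV \<and> comm_group G \<and> torsion_free G}"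
  by (auto simp: TFAB_omega_def group_structures_def space_restrict_space)

lemma group_operations_image: "group_operations ` space TFAB_omega = tfab_operations"
proof (intro equalityI subsetI)
  fix p
  assume "p \<in> group_operations ` space TFAB_omega"
  then obtain G where G: "p = group_operations G" "carrier G = UNIV" "comm_group G" "torsion_free G"
    by (auto simp: space_TFAB_omega)
  interpret comm_group G
    by (rule G(3))
  have pow: "((\<lambda>z. z \<otimes>\<^bsub>G\<^esub> x) ^^ Suc n) \<one>\<^bsub>G\<^esub> = \<one>\<^bsub>G\<^esub> \<Longrightarrow> x = \<one>\<^bsub>G\<^esub>" for x n
    using G(2,4) unfolding torsion_free_def nat_pow_eq_funpow by blast
  have inv: "\<exists>y. y \<otimes>\<^bsub>G\<^esub> x = \<one>\<^bsub>G\<^esub>" for x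
    using l_inv_ex[of x] G(2) by blast
  show "p \<in> tfab_operations"
    using m_assoc m_comm l_one pow inv unfolding tfab_operations_def G(1) group_operations_def
    by (auto simp: G(2) simp del: funpow.simps)
next
  fix p
  assume p: "p \<in> tfab_operations"
  define G :: "nat monoid" where "G = \<lparr>carrier = UNIV, mult = \<lambda>x y. fst p (x, y), one = snd p\<rparr>"
  note p' = p[unfolded tfab_operations_def mem_Collect_eq]
  note assoc = p'[THEN conjunct1] and rest = p'[THEN conjunct2]
  note unit = rest[THEN conjunct1] and rest = rest[THEN conjunct2]
  note comm = rest[THEN conjunct1] and inv = rest[THEN conjunct2, THEN conjunct1]
    and pow = rest[THEN conjunct2, THEN conjunct2]
  have "comm_group G"
  proof (rule comm_groupI)
    show "x \<otimes>\<^bsub>G\<^esub> y \<otimes>\<^bsub>G\<^esub> z = x \<otimes>\<^bsub>G\<^esub> (y \<otimes>\<^bsub>G\<^esub> z)" for x y z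
      by (simp add: G_def assoc)
    show "x \<otimes>\<^bsub>G\<^esub> y = y \<otimes>\<^bsub>G\<^esub> x" for x y
      using comm by (simp add: G_def)
  qed (simp_all add: G_def unit inv)
  moreover have "torsion_free G"
    unfolding torsion_free_def
  proof (intro ballI allI impI)
    fix x and n :: nat
    assume n: "0 < n" "x [^]\<^bsub>G\<^esub> n = \<one>\<^bsub>G\<^esub>"
    then obtain m where "n = Suc m"
      using gr0_implies_Suc by blast
    with n(2) have "((\<lambda>z. fst p (z, x)) ^^ Suc m) (snd p) = snd p"
      unfolding nat_pow_eq_funpow by (simp add: G_def del: funpow.simps)
    then have "x = snd p"
      by (rule pow[rule_format])
    then show "x = \<one>\<^bsub>G\<^esub>"
      by (simp add: G_def)
  qed
  ultimately have "G \<in> space TFAB_omega"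
    by (simp add: space_TFAB_omega G_def)
  moreover have "group_operations G = p"
    by (simp add: group_operations_def G_def)
  ultimately show "p \<in> group_operations ` space TFAB_omega"
    by blast
qed

lemma inj_on_group_operations: "inj_on group_operations (space TFAB_omega)"
proof (rule inj_onI)
  fix G K
  assume "G \<in> space TFAB_omega" "K \<in> space TFAB_omega" "group_operations G = group_operations K"
  then show "G = K"
    by (intro monoid.equality) (auto simp: space_TFAB_omega group_operations_def fun_eq_iff)
qed

lemma measurable_TFAB_omega_mult: "Measurable.pred TFAB_omega (\<lambda>G. a \<otimes>\<^bsub>G\<^esub> b = d)"
  and measurable_TFAB_omega_one: "Measurable.pred TFAB_omega (\<lambda>G. \<one>\<^bsub>G\<^esub> = d)"
proof -
  let ?F = "\<lambda>G :: nat monoid. (\<lambda>(x, y, z). x \<otimes>\<^bsub>G\<^esub> y = z, \<lambda>z. \<one>\<^bsub>G\<^esub> = z)"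
  have "?F \<in> borel_measurable group_structures"
    unfolding group_structures_def by (rule measurable_vimage_algebra1) simp
  then have F: "?F \<in> borel_measurable TFAB_omega"
    unfolding TFAB_omega_def by (rule measurable_restrict_space1)
  have "(\<lambda>G. fst (?F G)) \<in> borel_measurable TFAB_omega"
    by (rule measurable_compose[OF F]) (intro borel_measurable_continuous_onI continuous_intros)
  from measurable_product_then_coordinatewise[OF this, of "(a, b, d)"]
  show "Measurable.pred TFAB_omega (\<lambda>G. a \<otimes>\<^bsub>G\<^esub> b = d)"
    by (simp add: measurable_borel_bool)
  have "(\<lambda>G. snd (?F G)) \<in> borel_measurable TFAB_omega"
    by (rule measurable_compose[OF F]) (intro borel_measurable_continuous_onI continuous_intros)
  from measurable_product_then_coordinatewise[OF this, of d]
  show "Measurable.pred TFAB_omega (\<lambda>G. \<one>\<^bsub>G\<^esub> = d)"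
    by (simp add: measurable_borel_bool)
qed

lemma measurable_borel_nat: "measurable M (borel :: nat measure) = measurable M (count_space UNIV)"
  by (rule measurable_cong_sets) (simp_all add: sets_borel_eq_count_space)

lemma measurable_nat_pred:
  fixes f :: "'a \<Rightarrow> nat"
  assumes "\<And>k. Measurable.pred M (\<lambda>x. f x = k)"
  shows "f \<in> measurable M (count_space UNIV)"
proof -
  have "f -` {k} \<inter> space M \<in> sets M" for k
    using assms[of k] by (simp add: pred_def vimage_def Int_def conj_commute)
  then show ?thesis
    by (simp add: measurable_count_space_eq2_countable)
qed

text \<open>Graphs and operations generate the same sigma-algebra, since a function into
  \<open>nat\<close> is measurable exactly when its fibres are.\<close>

lemma sets_TFAB_omega:
  "sets TFAB_omega = sets (vimage_algebra (space TFAB_omega) group_operations borel)"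
    (is "_ = sets ?N")
proof
  have ops: "group_operations \<in> borel_measurable ?N"
    by (rule measurable_vimage_algebra1) simp
  have "(\<lambda>G. fst (group_operations G)) \<in> borel_measurable ?N"
    by (rule measurable_compose[OF ops]) (intro borel_measurable_continuous_onI continuous_intros)
  from measurable_product_then_coordinatewise[OF this]
  have mult: "(\<lambda>G. a \<otimes>\<^bsub>G\<^esub> b) \<in> measurable ?N (count_space UNIV)" for a b
    by (auto simp: group_operations_def measurable_borel_nat dest: meta_spec[of _ "(a, b)"])
  have "(\<lambda>G. snd (group_operations G)) \<in> borel_measurable ?N"
    by (rule measurable_compose[OF ops]) (intro borel_measurable_continuous_onI continuous_intros)
  then have one: "(\<lambda>G. \<one>\<^bsub>G\<^esub>) \<in> measurable ?N (count_space UNIV)"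
    by (simp add: group_operations_def measurable_borel_nat)
  have "(\<lambda>G. G) \<in> measurable ?N TFAB_omega"
    unfolding TFAB_omega_def
  proof (rule measurable_restrict_space2)
    show "(\<lambda>G. G) \<in> measurable (vimage_algebra (space (restrict_space group_structures
        {G. comm_group G \<and> torsion_free G})) group_operations borel) group_structures"
      unfolding TFAB_omega_def[symmetric]
    proof (rule measurable_group_structures)
      show "carrier G = UNIV" if "G \<in> space ?N" for G
        using that by (simp add: space_TFAB_omega)
      show "Measurable.pred ?N (\<lambda>G. a \<otimes>\<^bsub>G\<^esub> b = d)" for a b d
        by (rule measurable_compose[OF mult measurable_count_space])
      show "Measurable.pred ?N (\<lambda>G. \<one>\<^bsub>G\<^esub> = d)" for d
        by (rule measurable_compose[OF one measurable_count_space])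
    qed
  qed (auto simp: space_restrict_space)
  from measurable_sets[OF this] show "sets TFAB_omega \<subseteq> sets ?N"
    using sets.sets_into_space by (auto simp: Int_absorb2)
  show "sets ?N \<subseteq> sets TFAB_omega"
  proof (rule sets_image_in_sets[OF refl])
    have "(\<lambda>G. case q of (x, y) \<Rightarrow> x \<otimes>\<^bsub>G\<^esub> y) \<in> borel_measurable TFAB_omega" for q :: "nat \<times> nat"
      unfolding measurable_borel_nat
      by (rule measurable_nat_pred) (simp add: measurable_TFAB_omega_mult case_prod_beta)
    then have "(\<lambda>G. \<lambda>(x, y). x \<otimes>\<^bsub>G\<^esub> y) \<in> borel_measurable TFAB_omega"
      by (rule measurable_coordinatewise_then_product)
    moreover have "(\<lambda>G. \<one>\<^bsub>G\<^esub>) \<in> borel_measurable TFAB_omega"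
      unfolding measurable_borel_nat
      by (rule measurable_nat_pred) (rule measurable_TFAB_omega_one)
    ultimately show "group_operations \<in> borel_measurable TFAB_omega"
      unfolding group_operations_def by (rule borel_measurable_Pair)
  qed
qed

text \<open>Pulling the topology back along the injection \<open>group_operations\<close> identifies
  the space with a G-delta subspace of a Polish space, which is again Polish.\<close>

lemma standard_borel_space_TFAB_omega: "standard_borel_space TFAB_omega"
  unfolding standard_borel_space_def
proof (intro exI conjI)
  let ?S = "space TFAB_omega"
  let ?X = "pullback_topology ?S group_operations euclidean"
  let ?Y = "subtopology euclidean tfab_operations"
  have top: "topspace ?X = ?S"
    by (simp add: topspace_pullback_topology)
  have "homeomorphic_map ?X ?Y group_operations"
  proof (rule bijective_open_imp_homeomorphic_map)
    show "continuous_map ?X ?Y group_operations"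
      unfolding continuous_map_def top
    proof (intro conjI allI impI)
      show "group_operations \<in> ?S \<rightarrow> topspace ?Y"
        using group_operations_image by auto
      fix U
      assume "openin ?Y U"
      then obtain V where V: "open V" "U = V \<inter> tfab_operations"
        by (auto simp: openin_subtopology)
      then have "{G \<in> ?S. group_operations G \<in> U} = group_operations -` V \<inter> ?S"
        using group_operations_image by auto
      with V(1) show "openin ?X {G \<in> ?S. group_operations G \<in> U}"
        by (auto simp: openin_pullback_topology)
    qed
    show "open_map ?X ?Y group_operations"
      unfolding open_map_def
    proof (intro allI impI)
      fix U
      assume "openin ?X U"
      then obtain V where V: "open V" "U = group_operations -` V \<inter> ?S"
        by (auto simp: openin_pullback_topology)
      then have "group_operations ` U = V \<inter> tfab_operations"
        unfolding V(2) group_operations_image[symmetric] by blast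
      with V(1) show "openin ?Y (group_operations ` U)"
        by (auto simp: openin_subtopology)
    qed
    show "group_operations ` topspace ?X = topspace ?Y"
      by (simp add: top group_operations_image)
    show "inj_on group_operations (topspace ?X)"
      by (simp add: top inj_on_group_operations)
  qed
  then have hom: "?X homeomorphic_space ?Y"
    by (rule homeomorphic_map_imp_homeomorphic_space)
  show "completely_metrizable_space ?X"
    unfolding homeomorphic_completely_metrizable_space[OF hom]
    by (rule completely_metrizable_space_gdelta_in[OF completely_metrizable_space_euclidean_operations
          gdelta_tfab_operations])
  show "second_countable ?X"
    unfolding homeomorphic_space_second_countability[OF hom]
    by (rule second_countable_subtopology[OF second_countable_euclidean])
  \<comment> \<open>Taking preimages commutes with generating a sigma-algebra, so the pulled-back
    open sets generate the pulled-back Borel sets.\<close>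
  have "vimage_algebra ?S group_operations borel = sigma ?S {group_operations -` A \<inter> ?S |A. A \<in> {U. open U}}"
    unfolding borel_def by (rule vimage_algebra_sigma) auto
  then have "sets TFAB_omega = sets (sigma ?S {group_operations -` A \<inter> ?S |A. A \<in> {U. open U}})"
    by (simp only: sets_TFAB_omega)
  also have "\<dots> = sigma_sets ?S {group_operations -` A \<inter> ?S |A. A \<in> {U. open U}}"
    by (rule sets_measure_of) auto
  also have "{group_operations -` A \<inter> ?S |A. A \<in> {U. open U}} = {U. openin ?X U}"
    by (auto simp: openin_pullback_topology)
  finally show "sets TFAB_omega = sigma_sets (topspace ?X) {U. openin ?X U}"
    unfolding top .
qed

section \<open>The Borel map from trees to groups and the completeness that follows from it\<close>

theorem theorem1p10:
  shows "complete_coanalytic TYPE('x) TFAB_omega {G \<in> space TFAB_omega. endorigid G} \<and>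
    (\<exists>F \<in> measurable trees_omega TFAB_omega. \<forall>T \<in> space trees_omega.
       (let G = F T in
         (well_founded_tree T \<longrightarrow> endorigid G) \<and>
         (\<not> well_founded_tree T \<longrightarrow>
           (\<exists>f \<in> hom G G. inj_on f (carrier G) \<and> \<not> integer_multiplication G f \<and>
              \<not> torsion_group (G Mod (f ` carrier G))))))"
proof
  have tree: "tree T" if "T \<in> space trees_omega" for T
    using that by (simp add: trees_omega_def space_restrict_space)
  show "\<exists>F \<in> measurable trees_omega TFAB_omega. \<forall>T \<in> space trees_omega.
       (let G = F T in
         (well_founded_tree T \<longrightarrow> endorigid G) \<and>
         (\<not> well_founded_tree T \<longrightarrow>
           (\<exists>f \<in> hom G G. inj_on f (carrier G) \<and> \<not> integer_multiplication G f \<and>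
              \<not> torsion_group (G Mod (f ` carrier G)))))"
  proof (rule bexI[OF _ measurable_tree_group], rule ballI)
    fix T
    assume "T \<in> space trees_omega"
    from endorigid_tree_group[OF tree[OF this]] not_rigid_tree_group[OF tree[OF this]]
    show "let G = tree_group T in
         (well_founded_tree T \<longrightarrow> endorigid G) \<and>
         (\<not> well_founded_tree T \<longrightarrow>
           (\<exists>f \<in> hom G G. inj_on f (carrier G) \<and> \<not> integer_multiplication G f \<and>
              \<not> torsion_group (G Mod (f ` carrier G))))"
      unfolding Let_def by (intro conjI impI)
  qed
  \<comment> \<open>Without well-foundedness the injective \<open>f\<close> is an endomorphism that
    is no integer multiplication.\<close>
  have rigid: "endorigid (tree_group T) \<longleftrightarrow> well_founded_tree T" if "T \<in> space trees_omega" for T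
    using endorigid_tree_group[OF tree[OF that]] not_rigid_tree_group[OF tree[OF that]]
    unfolding endorigid_def by blast
  show "complete_coanalytic TYPE('x) TFAB_omega {G \<in> space TFAB_omega. endorigid G}"
    unfolding complete_coanalytic_def
  proof (intro conjI allI impI standard_borel_space_TFAB_omega)
    fix M :: "'x measure" and Y
    assume "coanalytic_set M Y"
    then have Y: "Y \<subseteq> space M" "analytic_set M (space M - Y)"
      by (simp_all add: coanalytic_set_def)
    \<comment> \<open>The scheme represents the complement of \<open>Y\<close>, so the points of
      \<open>Y\<close> are those whose tree is well-founded.\<close>
    obtain P :: "nat \<Rightarrow> (nat \<Rightarrow> nat) \<Rightarrow> 'x set" where P: "local_scheme M P" "\<forall>x\<in>space M. x \<in> space M - Y \<longleftrightarrow> (\<exists>w. \<forall>n. x \<in> P n w)"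
      by (rule analytic_set_scheme[OF Y(2)])
    note meas = measurable_scheme_tree[OF P(1)]
    have Yx: "x \<in> Y \<longleftrightarrow> tree_group (scheme_tree P x) \<in> {G \<in> space TFAB_omega. endorigid G}"
      if x: "x \<in> space M" for x
    proof -
      have T: "scheme_tree P x \<in> space trees_omega"
        by (rule measurable_space[OF meas x])
      have "tree_group (scheme_tree P x) \<in> space TFAB_omega"
        by (rule measurable_space[OF measurable_tree_group T])
      moreover have "x \<in> Y \<longleftrightarrow> well_founded_tree (scheme_tree P x)"
        using bspec[OF P(2) x] well_founded_scheme_tree[OF P(1), of x] x by auto
      ultimately show ?thesis
        by (simp add: rigid[OF T])
    qed
    show "borel_reducible M Y TFAB_omega {G \<in> space TFAB_omega. endorigid G}"
      unfolding borel_reducible_def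
    proof (rule bexI[of _ "\<lambda>x. tree_group (scheme_tree P x)"], rule ballI, rule Yx)
      show "(\<lambda>x. tree_group (scheme_tree P x)) \<in> measurable M TFAB_omega"
        by (rule measurable_compose[OF meas measurable_tree_group])
    qed
  qed (rule Collect_subset)
qed

end
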